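(* Let $\mathcal{B}$ be a bubble with pairing $\Omega$ and $\tilde{\mathcal{M}}$ a reduced map for $(\mathcal{B},\Omega)$. Let $\mathcal{W}\in\mathbb{W}_0(\tilde{\mathcal{M}})$, and let $\mathcal{T}\in\mathbb{W}_0(\tilde{\mathcal{M}})$ be such that $P(\mathcal{T})$ is a tree with the same number of white vertices as $P(\mathcal{W})$. Then $$\mathcal{F}(\mathcal{W})-\mathcal{F}(\mathcal{T}) = -D\,L(\mathcal{W})+2\sum_{i=1}^D l(\mathcal{W}^{(i)})-2\sum_{i=1}^D g(\mathcal{W}^{(i)}),$$ where $l(\mathcal{W}^{(i)})$ and $g(\mathcal{W}^{(i)})$ are the circuit rank and genus of the monochromatic submap of color $i$ and $L(\mathcal{W})$ is the circuit rank of the projected map $P(\mathcal{W})$.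
   Context: Write $[D]=\{1,\dots,D\}$, $D\ge2$. A bubble is a finite connected bipartite graph with edges colored in $[D]$, each vertex incident to exactly one edge of each color; a pairing $\Omega$ partitions its vertices into (white, black) pairs. From $(\mathcal{B},\Omega)$ build the directed graph $\mathcal{B}_{\circlearrowleft,\Omega}$ (one vertex per pair; for each edge of color $i$ from the white vertex of pair $x$ to the black vertex of pair $y\ne x$, a directed edge of color $i$ from $x$ to $y$), and the map $\mathcal{M}(\mathcal{B},\Omega)$: embed $\mathcal{B}_{\circlearrowleft,\Omega}$ with one cilium (marked corner) per vertex so that clockwise from the cilium one meets all outgoing edges then all incoming edges, then forget orientations. Each monochromatic submap of $\mathcal{M}(\mathcal{B},\Omega)$ is a disjoint union of cycles and isolated vertices. A reduced map $\tilde{\mathcal{M}}$ is obtained by treating every such cycle either by deleting one of its edges, or by deleting all its edges and adding a new unciliated vertex joined by an edge of color $i$ to each vertex of the cycle (in cyclic order). $\mathbb{W}_0(\tilde{\mathcal{M}})$: connected maps with black and blue vertices, black vertices adjacent only to blue ones, such that deleting black vertices and replacing each black–blue edge by a cilium at the blue endpoint yields disjoint copies of $\tilde{\mathcal{M}}$; each black–blue edge is labeled by the set of colors incident to its blue endpoint in $\tilde{\mathcal{M}}$; edges between blue vertices carry a single color. The projected map $P(\mathcal{W})$ is obtained by contracting each copy of $\tilde{\mathcal{M}}$ to a single white vertex. For $i\in[D]$, $\mathcal{W}^{(i)}$ is the (generally disconnected) map obtained by deleting all edges whose color label does not contain $i$, keeping all vertices. For a map $X$ with $\mathcal{V}$ vertices,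 $\mathcal{E}$ edges, $\mathcal{F}$ faces (an isolated vertex counting as one face) and $k$ connected components, the circuit rank is $l(X)=\mathcal{E}-\mathcal{V}+k$ and the genus $g(X)$ is defined by $\mathcal{F}=2k-2g+\mathcal{E}-\mathcal{V}$. $\mathcal{F}(\mathcal{W})=\sum_{i=1}^D\mathcal{F}(\mathcal{W}^{(i)})$. *)

theory Defs
  imports Complex_Main "HOL-Combinatorics.Orbits"
begin

definition reach :: "'v set \<Rightarrow> 'v rel \<Rightarrow> 'v rel" where
  "reach V R = {(x, y). x \<in> V \<and> y \<in> V \<and> (x, y) \<in> (R \<union> R\<inverse>)\<^sup>*}"

definition connected_by :: "'v set \<Rightarrow> 'v rel \<Rightarrow> bool" where
  "connected_by V R \<longleftrightarrow> V \<noteq> {} \<and> (\<forall>x\<in>V. \<forall>y\<in>V. (x, y) \<in> reach V R)"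

text \<open>
  Multigraphs are given by half-edges (darts): \<open>att\<close> is the vertex a dart is attached to and
  \<open>flip\<close> is the involution exchanging the two halves of an edge. A dart fixed by \<open>flip\<close>
  is a cilium; it marks a corner and is not an edge. In a map, \<open>rot\<close> sends a dart to
  the next one clockwise around its vertex. Vertices without darts are allowed.
\<close>

record ('v, 'h) graph =
  verts :: "'v set"
  darts :: "'h set"
  att   :: "'h \<Rightarrow> 'v"
  flip  :: "'h \<Rightarrow> 'h"

record ('v, 'h) cmap = "('v, 'h) graph" +
  rot   :: "'h \<Rightarrow> 'h"

record ('v, 'h) colored_map = "('v, 'h) cmap" +
  label :: "'h \<Rightarrow> nat set"

definition wf_graph :: "('v, 'h, 'z) graph_scheme \<Rightarrow> bool" where
  "wf_graph G \<longleftrightarrow> finite (verts G) \<and> finite (darts G) \<and> att G ` darts G \<subseteq> verts G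
     \<and> (\<forall>h\<in>darts G. flip G h \<in> darts G \<and> flip G (flip G h) = h)"

text \<open>
  The last condition says that \<open>rot\<close> cyclically permutes the darts of each vertex.
\<close>

definition wf_map :: "('v, 'h, 'z) colored_map_scheme \<Rightarrow> bool" where
  "wf_map M \<longleftrightarrow> wf_graph M
     \<and> (\<forall>h\<in>darts M. label M (flip M h) = label M h)
     \<and> (\<forall>h\<in>darts M. orbit (rot M) h = {h' \<in> darts M. att M h' = att M h})"

definition adj :: "('v, 'h, 'z) graph_scheme \<Rightarrow> 'v rel" where
  "adj G = {(att G h, att G (flip G h)) | h. h \<in> darts G}"

definition component_of :: "('v, 'h, 'z) graph_scheme \<Rightarrow> 'v \<Rightarrow> 'v set" where
  "component_of G v = reach (verts G) (adj G) `` {v}"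

definition components :: "('v, 'h, 'z) graph_scheme \<Rightarrow> 'v set set" where
  "components G = component_of G ` verts G"

definition connected_graph :: "('v, 'h, 'z) graph_scheme \<Rightarrow> bool" where
  "connected_graph G \<longleftrightarrow> connected_by (verts G) (adj G)"

definition edges :: "('v, 'h, 'z) graph_scheme \<Rightarrow> 'h set set" where
  "edges G = {{h, flip G h} | h. h \<in> darts G \<and> flip G h \<noteq> h}"

text \<open>
  A cycle is listed by its darts, each pointing to the vertex of the next one. The last
  condition forbids using an edge in both directions; a loop is a cycle of length one.
\<close>

definition graph_cycle :: "('v, 'h, 'z) graph_scheme \<Rightarrow> 'h list \<Rightarrow> bool" where
  "graph_cycle G hs \<longleftrightarrow> hs \<noteq> [] \<and> (\<forall>h\<in>set hs. h \<in> darts G \<and> flip G h \<noteq> h)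
     \<and> distinct (map (att G) hs)
     \<and> map (\<lambda>h. att G (flip G h)) hs = rotate1 (map (att G) hs)
     \<and> (\<forall>h\<in>set hs. flip G h \<notin> set hs)"

definition is_tree :: "('v, 'h, 'z) graph_scheme \<Rightarrow> bool" where
  "is_tree G \<longleftrightarrow> connected_graph G \<and> (\<nexists>hs. graph_cycle G hs)"

definition circuit_rank :: "('v, 'h, 'z) graph_scheme \<Rightarrow> int" where
  "circuit_rank G = int (card (edges G)) - int (card (verts G)) + int (card (components G))"

definition num_faces :: "('v, 'h, 'z) cmap_scheme \<Rightarrow> nat" where
  "num_faces M = card (orbit (\<lambda>h. rot M (flip M h)) ` darts M)
     + card (verts M - att M ` darts M)"

text \<open>The solution \<open>g\<close> of \<open>F = 2 k - 2 g + E - V\<close>.\<close>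

definition genus :: "('v, 'h, 'z) cmap_scheme \<Rightarrow> real" where
  "genus M = (2 * real (card (components M)) + real (card (edges M))
     - real (card (verts M)) - real (num_faces M)) / 2"

definition first_return :: "('h \<Rightarrow> 'h) \<Rightarrow> 'h set \<Rightarrow> 'h \<Rightarrow> 'h" where
  "first_return f S h = (f ^^ (LEAST n. 0 < n \<and> (f ^^ n) h \<in> S)) h"

definition mono_submap :: "nat \<Rightarrow> ('v, 'h, 'z) colored_map_scheme \<Rightarrow> ('v, 'h, 'z) colored_map_scheme" where
  "mono_submap i M = (let S = {h \<in> darts M. i \<in> label M h} in
     M\<lparr>darts := S, rot := first_return (rot M) S\<rparr>)"

definition total_faces :: "nat \<Rightarrow> ('v, 'h, 'z) colored_map_scheme \<Rightarrow> nat" where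
  "total_faces D M = (\<Sum>i=1..D. num_faces (mono_submap i M))"

definition map_iso :: "('v, 'h, 'y) colored_map_scheme \<Rightarrow> ('w, 'k, 'z) colored_map_scheme \<Rightarrow> bool" where
  "map_iso A B \<longleftrightarrow> (\<exists>f g. bij_betw f (verts A) (verts B) \<and> bij_betw g (darts A) (darts B)
     \<and> (\<forall>h\<in>darts A. att B (g h) = f (att A h) \<and> flip B (g h) = g (flip A h)
          \<and> rot B (g h) = g (rot A h) \<and> label B (g h) = label A h))"

record ('a, 'e) bubble =
  whites :: "'a set"
  blacks :: "'a set"
  bedges :: "'e set"
  wend   :: "'e \<Rightarrow> 'a"
  bend   :: "'e \<Rightarrow> 'a"
  bcol   :: "'e \<Rightarrow> nat"

definition is_bubble :: "nat \<Rightarrow> ('a, 'e) bubble \<Rightarrow> bool" where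
  "is_bubble D B \<longleftrightarrow> finite (whites B) \<and> finite (blacks B) \<and> finite (bedges B)
     \<and> whites B \<inter> blacks B = {}
     \<and> (\<forall>e\<in>bedges B. wend B e \<in> whites B \<and> bend B e \<in> blacks B \<and> bcol B e \<in> {1..D})
     \<and> (\<forall>v\<in>whites B. \<forall>i\<in>{1..D}. \<exists>!e. e \<in> bedges B \<and> bcol B e = i \<and> wend B e = v)
     \<and> (\<forall>v\<in>blacks B. \<forall>i\<in>{1..D}. \<exists>!e. e \<in> bedges B \<and> bcol B e = i \<and> bend B e = v)
     \<and> connected_by (whites B \<union> blacks B) {(wend B e, bend B e) | e. e \<in> bedges B}"

definition is_pairing :: "('a, 'e) bubble \<Rightarrow> ('a \<times> 'a) set \<Rightarrow> bool" where
  "is_pairing B \<Omega> \<longleftrightarrow> \<Omega> \<subseteq> whites B \<times> blacks B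
     \<and> (\<forall>w\<in>whites B. \<exists>!b. (w, b) \<in> \<Omega>) \<and> (\<forall>b\<in>blacks B. \<exists>!w. (w, b) \<in> \<Omega>)"

record ('p, 'e) colored_digraph =
  nodes :: "'p set"
  arcs  :: "'e set"
  src   :: "'e \<Rightarrow> 'p"
  tgt   :: "'e \<Rightarrow> 'p"
  acol  :: "'e \<Rightarrow> nat"

definition pair_digraph ::
    "('a, 'e) bubble \<Rightarrow> ('a \<times> 'a) set \<Rightarrow> ('a \<times> 'a, 'e) colored_digraph" where
  "pair_digraph B \<Omega> =
     (let s = (\<lambda>e. THE x. x \<in> \<Omega> \<and> fst x = wend B e);
          t = (\<lambda>e. THE y. y \<in> \<Omega> \<and> snd y = bend B e)
      in \<lparr>nodes = \<Omega>, arcs = {e \<in> bedges B. t e \<noteq> s e}, src = s, tgt = t, acol = bcol B\<rparr>)"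

datatype ('p, 'e) mdart = Cilium 'p | Out 'e | In 'e

text \<open>
  The order among the outgoing edges of a vertex, and among its incoming edges, is left free.
  Cilia carry the empty label, so they belong to no monochromatic submap.
\<close>

definition is_ciliated_map ::
    "('p, 'e) colored_digraph \<Rightarrow> ('p, ('p, 'e) mdart) colored_map \<Rightarrow> bool" where
  "is_ciliated_map G M \<longleftrightarrow>
     verts M = nodes G
     \<and> darts M = Cilium ` nodes G \<union> Out ` arcs G \<union> In ` arcs G
     \<and> (\<forall>x\<in>nodes G. att M (Cilium x) = x \<and> flip M (Cilium x) = Cilium x \<and> label M (Cilium x) = {})
     \<and> (\<forall>e\<in>arcs G. att M (Out e) = src G e \<and> flip M (Out e) = In e \<and> label M (Out e) = {acol G e})
     \<and> (\<forall>e\<in>arcs G. att M (In e) = tgt G e \<and> flip M (In e) = Out e \<and> label M (In e) = {acol G e})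
     \<and> (\<forall>x\<in>nodes G. \<exists>outs ins. distinct outs \<and> distinct ins
          \<and> set outs = {e \<in> arcs G. src G e = x} \<and> set ins = {e \<in> arcs G. tgt G e = x}
          \<and> (let c = Cilium x # map Out outs @ map In ins in map (rot M) c = rotate1 c))"

definition is_bubble_map ::
    "('a, 'e) bubble \<Rightarrow> ('a \<times> 'a) set \<Rightarrow> ('a \<times> 'a, ('a \<times> 'a, 'e) mdart) colored_map \<Rightarrow> bool" where
  "is_bubble_map B \<Omega> M \<longleftrightarrow> is_ciliated_map (pair_digraph B \<Omega>) M"

text \<open>
  A monochromatic cycle is represented by its color and its vertex set: in the map of a bubble
  the components of a monochromatic submap are cycles and isolated vertices.
\<close>

definition mono_cycles :: "nat \<Rightarrow> ('v, 'h) colored_map \<Rightarrow> (nat \<times> 'v set) set" where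
  "mono_cycles D M = {(i, C). i \<in> {1..D} \<and> C \<in> components (mono_submap i M)
     \<and> C \<inter> att M ` darts (mono_submap i M) \<noteq> {}}"

text \<open>
  \<open>t (i, C) = Some e\<close> means that the edge \<open>e\<close> of the cycle is deleted, and
  \<open>t (i, C) = None\<close> that the cycle is replaced by a star.
\<close>

definition is_treatment ::
    "nat \<Rightarrow> ('v, 'h) colored_map \<Rightarrow> (nat \<times> 'v set \<Rightarrow> 'h set option) \<Rightarrow> bool" where
  "is_treatment D M t \<longleftrightarrow> (\<forall>(i, C) \<in> mono_cycles D M. \<forall>e. t (i, C) = Some e \<longrightarrow>
     e \<in> edges (mono_submap i M) \<and> att M ` e \<subseteq> C)"

definition starred ::
    "nat \<Rightarrow> ('v, 'h) colored_map \<Rightarrow> (nat \<times> 'v set \<Rightarrow> 'h set option) \<Rightarrow> (nat \<times> 'v set) set" where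
  "starred D M t = {c \<in> mono_cycles D M. t c = None}"

definition kept_darts ::
    "nat \<Rightarrow> ('v, 'h) colored_map \<Rightarrow> (nat \<times> 'v set \<Rightarrow> 'h set option) \<Rightarrow> 'h set" where
  "kept_darts D M t = {h \<in> darts M. \<forall>(i, C) \<in> mono_cycles D M.
     i \<in> label M h \<and> att M h \<in> C \<longrightarrow> (\<exists>e. t (i, C) = Some e \<and> h \<notin> e)}"

datatype 'v rvert = Old 'v | Hub nat "'v set"

text \<open>
  The edge joining the vertex \<open>x\<close> of the cycle \<open>(i, C)\<close> to the new vertex \<open>Hub i C\<close> consists
  of the darts \<open>Spoke i C x\<close> at \<open>x\<close> and \<open>Ray i C x\<close> at the new vertex.
\<close>

datatype ('v, 'h) rdart = Kept 'h | Spoke nat "'v set" 'v | Ray nat "'v set" 'v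

text \<open>
  At an old vertex the remaining edges and the cilium keep their cyclic order, and the new
  edges may be inserted in any corner. Around a new vertex the cyclic order is that of the
  cycle, traversed in either direction.
\<close>

definition is_reduction_by ::
    "nat \<Rightarrow> ('v, 'h) colored_map \<Rightarrow> (nat \<times> 'v set \<Rightarrow> 'h set option)
       \<Rightarrow> ('v rvert, ('v, 'h) rdart) colored_map \<Rightarrow> bool" where
  "is_reduction_by D M t R \<longleftrightarrow> (let K = kept_darts D M t; S = starred D M t in
     wf_map R
     \<and> verts R = Old ` verts M \<union> {Hub i C | i C. (i, C) \<in> S}
     \<and> darts R = Kept ` K \<union> {Spoke i C x | i C x. (i, C) \<in> S \<and> x \<in> C}
                          \<union> {Ray i C x | i C x. (i, C) \<in> S \<and> x \<in> C}
     \<and> (\<forall>h\<in>K. att R (Kept h) = Old (att M h) \<and> flip R (Kept h) = Kept (flip M h)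
          \<and> label R (Kept h) = label M h
          \<and> first_return (rot R) (Kept ` K) (Kept h) = Kept (first_return (rot M) K h))
     \<and> (\<forall>(i, C)\<in>S. \<forall>x\<in>C.
          att R (Spoke i C x) = Old x \<and> flip R (Spoke i C x) = Ray i C x \<and> label R (Spoke i C x) = {i}
          \<and> att R (Ray i C x) = Hub i C \<and> flip R (Ray i C x) = Spoke i C x \<and> label R (Ray i C x) = {i})
     \<and> (\<forall>(i, C)\<in>S. \<exists>xs. distinct xs \<and> set xs = C
          \<and> list_all2 (\<lambda>x y. (x, y) \<in> adj (mono_submap i M)) xs (rotate1 xs)
          \<and> map (rot R) (map (Ray i C) xs) = rotate1 (map (Ray i C) xs)))"

definition is_reduced_map ::
    "nat \<Rightarrow> ('a, 'e) bubble \<Rightarrow> ('a \<times> 'a) set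
       \<Rightarrow> (('a \<times> 'a) rvert, ('a \<times> 'a, ('a \<times> 'a, 'e) mdart) rdart) colored_map \<Rightarrow> bool" where
  "is_reduced_map D B \<Omega> R \<longleftrightarrow>
     (\<exists>M t. is_bubble_map B \<Omega> M \<and> is_treatment D M t \<and> is_reduction_by D M t R)"

record ('v, 'h) stuffed_map = "('v, 'h) colored_map" +
  black_verts :: "'v set"

text \<open>Vertices that are not black are blue.\<close>

definition blue_part :: "('v, 'h) stuffed_map \<Rightarrow> ('v, 'h) colored_map" where
  "blue_part W = \<lparr>verts = verts W - black_verts W,
     darts = {h \<in> darts W. att W h \<notin> black_verts W},
     att = att W,
     flip = (\<lambda>h. if att W (flip W h) \<in> black_verts W then h else flip W h),
     rot = rot W,
     label = (\<lambda>h. if att W (flip W h) \<in> black_verts W then {} else label W h)\<rparr>"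

definition restrict_verts :: "('v, 'h) colored_map \<Rightarrow> 'v set \<Rightarrow> ('v, 'h) colored_map" where
  "restrict_verts M C = M\<lparr>verts := C, darts := {h \<in> darts M. att M h \<in> C}\<rparr>"

text \<open>
  Bubbles are connected and the treatment of cycles preserves connectedness, so reduced maps
  are connected and the copies of a reduced map in \<open>W\<close> are the components of the blue part.
\<close>

definition W0 :: "('w, 'k) colored_map \<Rightarrow> ('v, 'h) stuffed_map set" where
  "W0 R = {W. wf_map W \<and> (\<forall>h\<in>darts W. flip W h \<noteq> h) \<and> connected_graph W
     \<and> black_verts W \<subseteq> verts W
     \<and> (\<forall>h\<in>darts W. att W h \<in> black_verts W \<longrightarrow> att W (flip W h) \<notin> black_verts W)
     \<and> (\<forall>C\<in>components (blue_part W). map_iso (restrict_verts (blue_part W) C) R)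
     \<and> (\<forall>h\<in>darts W. att W (flip W h) \<in> black_verts W \<longrightarrow>
          label W h = \<Union> (label (blue_part W) ` {h' \<in> darts (blue_part W). att W h' = att W h}))}"

text \<open>
  Contracting a copy that contains cycles does not determine an embedding, so the projected map
  is taken as a graph. Black vertices are tagged \<open>Inl\<close>, white ones \<open>Inr\<close>.
\<close>

definition projected :: "('v, 'h) stuffed_map \<Rightarrow> ('v + 'v set, 'h) graph" where
  "projected W = \<lparr>verts = Inl ` black_verts W \<union> Inr ` components (blue_part W),
     darts = {h \<in> darts W. att W h \<in> black_verts W \<or> att W (flip W h) \<in> black_verts W},
     att = (\<lambda>h. if att W h \<in> black_verts W then Inl (att W h)
                else Inr (component_of (blue_part W) (att W h))),
     flip = flip W\<rparr>"

definition num_white :: "('v, 'h) stuffed_map \<Rightarrow> nat" where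
  "num_white W = card (verts (projected W) \<inter> range Inr)"

end

theory Submission
  imports Defs
begin

text \<open>
  By the definition of the genus, each monochromatic submap satisfies \<open>F = V - E + 2 l - 2 g\<close>.
  Every copy of the reduced map contributes the same numbers of vertices, cilia and darts of each
  color, so \<open>D V + D L - \<Sum>i. E i\<close> depends only on the number of copies. It remains to see that
  \<open>F = V - E\<close> for each monochromatic submap of a tree. Faces are the orbits of the rotation composed
  with the edge flips, starting from one face per vertex; switching on an edge composes this
  permutation with a transposition, which merges two faces if the edge is a bridge. So one switches
  on the edges inside the copies first, which are bridges because opening a cycle or replacing it by
  a star leaves a forest, and then the black-blue edges, which are bridges because the projected map
  is a tree.
\<close>

section \<open>Equivalence classes and orbits\<close>

text \<open>Bridges are certified by cuts: vertex sets that no other edge crosses. A cut survives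
  the removal of edges, can be pulled back along a contraction or along the isomorphism of a copy,
  and confines every face walk to the side where it starts; this last point is why the two ends of a
  new edge lie on different faces. The two passes are forced by the scope of the cuts: a cut found
  inside one copy may be crossed by black-blue edges, so it is used only while these are absent,
  whereas a cut of the tree separates everything. In the count, black vertices cancel: each adds D
  to D V and, being a vertex of the projected map, takes D away from D L. The edges of the projected
  map are the cilia of the copies, and their labels are dictated by the colors at the ciliated
  vertex, so each copy also fixes its share of every E i.\<close>

lemma reach_equiv: "equiv V (reach V R)"
proof (rule equivI)
  show "reach V R \<subseteq> V \<times> V" "refl_on V (reach V R)"
    by (auto simp: reach_def refl_on_def)
  have "sym ((R \<union> R\<inverse>)\<^sup>*)"
    by (rule sym_rtrancl) (auto simp: sym_def)
  then show "sym (reach V R)"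
    by (auto simp: reach_def sym_def)
  show "trans (reach V R)"
    by (rule transI) (auto simp: reach_def intro: rtrancl_trans)
qed

lemma reach_sym: "(x, y) \<in> reach V R \<Longrightarrow> (y, x) \<in> reach V R"
  using reach_equiv[of V R] by (auto simp: equiv_def dest: symD)

lemma reach_trans: "(x, y) \<in> reach V R \<Longrightarrow> (y, z) \<in> reach V R \<Longrightarrow> (x, z) \<in> reach V R"
  using reach_equiv[of V R] by (auto simp: equiv_def dest: transD)

lemma reach_edge: "(x, y) \<in> R \<Longrightarrow> x \<in> V \<Longrightarrow> y \<in> V \<Longrightarrow> (x, y) \<in> reach V R"
  by (auto simp: reach_def)

lemma reach_invariant:
  assumes "(x, y) \<in> reach V R" and "\<And>a b. (a, b) \<in> R \<Longrightarrow> P a \<longleftrightarrow> P b"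
  shows "P x \<longleftrightarrow> P y"
proof -
  have "(x, y) \<in> (R \<union> R\<inverse>)\<^sup>*"
    using assms(1) by (auto simp: reach_def)
  then show ?thesis
    by induction (use assms(2) in auto)
qed

lemma reach_induct [consumes 2, case_names refl step]:
  assumes "(x, y) \<in> reach V R" and "R \<subseteq> V \<times> V"
    and "Q x"
    and "\<And>y z. (x, y) \<in> reach V R \<Longrightarrow> Q y \<Longrightarrow> (y, z) \<in> R \<or> (z, y) \<in> R \<Longrightarrow> y \<in> V \<Longrightarrow> z \<in> V \<Longrightarrow> Q z"
  shows "Q y"
proof -
  have "(x, y) \<in> (R \<union> R\<inverse>)\<^sup>*" and x: "x \<in> V"
    using assms(1) by (auto simp: reach_def)
  from this(1) have "y \<in> V \<and> Q y"
  proof induction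
    case base
    then show ?case using x assms(3) by simp
  next
    case (step y z)
    then have "(x, y) \<in> reach V R" "z \<in> V"
      using x assms(2) by (auto simp: reach_def)
    then show ?case
      using step assms(4)[of y z] by blast
  qed
  then show ?thesis ..
qed

text \<open>Minimality reduces inclusions between \<open>reach\<close> relations to their
  generators.\<close>

lemma reach_least:
  assumes "R \<subseteq> V \<times> V" and "equiv V E" and "R \<subseteq> E"
  shows "reach V R \<subseteq> E"
proof
  fix p assume "p \<in> reach V R"
  then obtain x y where p: "p = (x, y)" and xy: "(x, y) \<in> reach V R" by (cases p) auto
  from xy assms(1) have "(x, y) \<in> E"
  proof (induction rule: reach_induct)
    case refl
    have "x \<in> V" using xy by (auto simp: reach_def)
    then show ?case using assms(2) by (auto simp: equiv_def refl_on_def)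
  next
    case (step y z)
    then show ?case
      using assms(2,3) unfolding equiv_def by (blast dest: symD transD)
  qed
  then show "p \<in> E" using p by simp
qed

text \<open>The union of the two touched classes is saturated, so making it one block gives an
  equivalence again; minimality of \<open>reach\<close> then yields the nontrivial
  inclusion.\<close>

lemma reach_insert:
  assumes "R \<subseteq> V \<times> V" and "a \<in> V" and "b \<in> V"
  shows "reach V (insert (a, b) R) =
    reach V R \<union> (reach V R `` {a, b}) \<times> (reach V R `` {a, b})"
    (is "?E' = ?E \<union> ?U \<times> ?U")
proof
  have refl: "(x, x) \<in> ?E" if "x \<in> V" for x using that by (auto simp: reach_def)
  have sub: "?E \<subseteq> V \<times> V" by (auto simp: reach_def)
  have closed: "y \<in> ?U \<longleftrightarrow> x \<in> ?U" if "(x, y) \<in> ?E" for x y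
    using that by (auto dest: reach_sym reach_trans)
  have "equiv V (?E \<union> ?U \<times> ?U)"
  proof (rule equivI)
    show "?E \<union> ?U \<times> ?U \<subseteq> V \<times> V" using sub by auto
    show "refl_on V (?E \<union> ?U \<times> ?U)" using refl by (auto simp: refl_on_def)
    show "sym (?E \<union> ?U \<times> ?U)" by (auto simp: sym_def intro: reach_sym)
    show "trans (?E \<union> ?U \<times> ?U)"
      unfolding trans_def using closed by (blast intro: reach_trans)
  qed
  moreover have "insert (a, b) R \<subseteq> ?E \<union> ?U \<times> ?U"
    using assms refl by (auto intro: reach_edge)
  ultimately show "?E' \<subseteq> ?E \<union> ?U \<times> ?U"
    using assms by (intro reach_least) auto
  have E: "?E \<subseteq> ?E'"
    using assms by (intro reach_least reach_equiv) (auto intro!: reach_edge)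
  have ab: "(a, b) \<in> ?E'" using assms by (auto intro: reach_edge)
  have "(a, x) \<in> ?E'" if "x \<in> ?U" for x
    using that E ab by (auto intro: reach_trans)
  then have "?U \<times> ?U \<subseteq> ?E'" by (auto intro: reach_trans reach_sym)
  then show "?E \<union> ?U \<times> ?U \<subseteq> ?E'" using E by blast
qed

text \<open>The classes of \<open>a\<close> and \<open>b\<close> give way to their union and all
  others survive. This one count serves both for merging faces and for merging components.\<close>

lemma card_quotient_reach_insert:
  assumes "finite V" "R \<subseteq> V \<times> V" "a \<in> V" "b \<in> V" "(a, b) \<notin> reach V R"
  shows "card (V // reach V R) = Suc (card (V // reach V (insert (a, b) R)))"
proof -
  let ?E = "reach V R" and ?A = "reach V R `` {a}" and ?B = "reach V R `` {b}"
  have eq: "equiv V ?E" by (rule reach_equiv)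
  have aA: "a \<in> ?A" "b \<in> ?B" using assms by (auto simp: reach_def)
  have U: "?E `` {a, b} = ?A \<union> ?B" by auto
  have img: "reach V (insert (a, b) R) `` {x} = (if x \<in> ?A \<union> ?B then ?A \<union> ?B else ?E `` {x})" for x
    unfolding reach_insert[OF assms(2-4)] U by (auto intro: reach_trans reach_sym)
  have cls: "?E `` {x} = ?A \<longleftrightarrow> x \<in> ?A" "?E `` {x} = ?B \<longleftrightarrow> x \<in> ?B" if "x \<in> V" for x
    using that assms eq_equiv_class_iff[OF eq] by (auto intro: reach_sym)
  have "V // reach V (insert (a, b) R) = insert (?A \<union> ?B) (V // ?E - {?A, ?B})" (is "?L = ?R")
  proof
    show "?L \<subseteq> ?R"
    proof
      fix X assume "X \<in> ?L"
      then obtain x where x: "x \<in> V" and X: "X = reach V (insert (a, b) R) `` {x}"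
        by (auto simp: quotient_def)
      show "X \<in> ?R"
      proof (cases "x \<in> ?A \<union> ?B")
        case True
        then show ?thesis using X img[of x] by simp
      next
        case False
        then have "X = ?E `` {x}" using X img[of x] by simp
        moreover have "?E `` {x} \<noteq> ?A" "?E `` {x} \<noteq> ?B" using False cls[OF x] by blast+
        ultimately show ?thesis using x by (auto intro: quotientI)
      qed
    qed
    have "?A \<union> ?B \<in> ?L"
      unfolding quotient_def using assms(3) aA img[of a] by auto
    moreover have "X \<in> ?L" if X: "X \<in> V // ?E - {?A, ?B}" for X
    proof -
      obtain x where "x \<in> V" "X = ?E `` {x}" using X by (auto elim: quotientE)
      with X cls have "X = reach V (insert (a, b) R) `` {x}"
        unfolding img by auto
      with \<open>x \<in> V\<close> show ?thesis by (auto intro: quotientI)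
    qed
    ultimately show "?R \<subseteq> ?L" by blast
  qed
  \<comment> \<open>The union is a new class, as it contains the inequivalent \<open>a\<close> and
    \<open>b\<close>; so two classes leave and exactly one enters.\<close>
  moreover have "?A \<union> ?B \<notin> V // ?E"
  proof
    assume "?A \<union> ?B \<in> V // ?E"
    then obtain x where "x \<in> V" and x: "?A \<union> ?B = ?E `` {x}" by (auto simp: quotient_def)
    have "a \<in> ?E `` {x}" "b \<in> ?E `` {x}" using aA x by blast+
    then have "(a, b) \<in> ?E" by (auto intro: reach_sym reach_trans)
    with assms show False by simp
  qed
  moreover have "?A \<in> V // ?E" "?B \<in> V // ?E" using assms by (auto intro: quotientI)
  moreover have "?A \<noteq> ?B" using assms aA by auto
  moreover have fin: "finite (V // ?E)"
    using assms(1) by (simp add: quotient_def)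
  moreover have "card {?A, ?B} \<le> card (V // ?E)"
    using calculation by (intro card_mono) auto
  ultimately show ?thesis
    by (simp add: card_Diff_subset)
qed

lemma components_quotient: "components G = verts G // reach (verts G) (adj G)"
  by (auto simp: components_def component_of_def quotient_def)

section \<open>Orbits of an injective self-map of a finite set\<close>

lemma self_in_orbit_finite:
  assumes "finite A" "f ` A \<subseteq> A" "inj_on f A" "x \<in> A"
  shows "x \<in> orbit f x"
proof (rule ccontr)
  assume x: "x \<notin> orbit f x"
  have sub: "orbit f x \<subseteq> A"
  proof
    fix y assume "y \<in> orbit f x"
    then show "y \<in> A" by induction (use assms in auto)
  qed
  then have fin: "finite (orbit f x)" using assms(1) finite_subset by blast
  \<comment> \<open>\<open>orbit f x\<close> starts at \<open>f x\<close>, so \<open>x\<close> has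
    to be recovered: were it missing, \<open>f\<close> would inject a set into one with one element
    fewer.\<close>
  have "card (insert x (orbit f x)) \<le> card (orbit f x)"
  proof (rule card_inj_on_le[OF _ _ fin])
    show "inj_on f (insert x (orbit f x))"
      by (rule inj_on_subset[OF assms(3)]) (use assms(4) sub in auto)
    show "f ` insert x (orbit f x) \<subseteq> orbit f x" by (auto intro: orbit.intros)
  qed
  with x fin show False by simp
qed

text \<open>Orbits can now be counted as equivalence classes. A backward step from
  \<open>f z\<close> to \<open>z\<close> is also a forward walk, because \<open>z\<close> returns to
  itself.\<close>

lemma orbit_eq_reach:
  assumes "finite A" "f ` A \<subseteq> A" "inj_on f A" "x \<in> A"
  shows "orbit f x = reach A {(a, f a) | a. a \<in> A} `` {x}"
proof (intro set_eqI iffI)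
  let ?R = "{(a, f a) | a. a \<in> A}"
  have R: "?R \<subseteq> A \<times> A" using assms(2) by auto
  fix y
  {
    assume "y \<in> orbit f x"
    then have "(x, y) \<in> reach A ?R"
    proof induction
      case base
      then show ?case using assms by (intro reach_edge) auto
    next
      case (step y)
      then have "y \<in> A" by (auto simp: reach_def)
      then have "(y, f y) \<in> reach A ?R" using assms by (intro reach_edge) auto
      with step show ?case by (blast intro: reach_trans)
    qed
    then show "y \<in> reach A ?R `` {x}" by simp
  }
  assume "y \<in> reach A ?R `` {x}"
  then have "(x, y) \<in> reach A ?R" by simp
  from this R show "y \<in> orbit f x"
  proof (induction rule: reach_induct)
    case refl
    show ?case using self_in_orbit_finite assms by metis
  next
    case (step y z)
    from step.hyps(2) show ?case
    proof
      assume "(y, z) \<in> ?R"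
      then show ?case using step.IH by (auto intro: orbit.step)
    next
      assume "(z, y) \<in> ?R"
      then have z: "y = f z" "z \<in> A" by auto
      have "z \<in> orbit f z" using self_in_orbit_finite assms z by metis
      then have "z \<in> orbit f (f z)" using self_in_orbit_step by metis
      with z step.IH show ?case by (auto intro: orbit_trans)
    qed
  qed
qed

lemma orbits_eq_quotient:
  assumes "finite A" "f ` A \<subseteq> A" "inj_on f A"
  shows "orbit f ` A = A // reach A {(a, f a) | a. a \<in> A}"
  using orbit_eq_reach[OF assms] by (auto simp: quotient_def)

text \<open>Swapping the values at points of two different cycles fuses the cycles: the classes of
  the composed map are those of \<open>f\<close> with one extra link from \<open>a\<close> to
  \<open>b\<close>.\<close>

lemma card_orbits_transpose:
  assumes fin: "finite A" and f: "f ` A \<subseteq> A" "inj_on f A" and ab: "a \<in> A" "b \<in> A"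
    and diff: "b \<notin> orbit f a"
  shows "card (orbit f ` A) = Suc (card (orbit (f \<circ> transpose a b) ` A))"
proof -
  let ?g = "f \<circ> transpose a b"
  let ?Rf = "{(x, f x) | x. x \<in> A}" and ?Rg = "{(x, ?g x) | x. x \<in> A}"
  have tA: "transpose a b ` A \<subseteq> A" using ab by (auto simp: transpose_def)
  have gA: "?g ` A \<subseteq> A" using tA f(1) by force
  have ginj: "inj_on ?g A"
    by (rule comp_inj_on) (use f(2) tA in \<open>auto intro: inj_on_subset\<close>)
  have RA: "?Rf \<subseteq> A \<times> A" "?Rg \<subseteq> A \<times> A" using f(1) gA by auto
  \<comment> \<open>Between \<open>f a\<close> and the return to \<open>a\<close> the walk meets
    neither \<open>a\<close>, by the bound on \<open>k\<close>, nor \<open>b\<close>, which is in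
    another orbit; there the composed map agrees with \<open>f\<close>.\<close>
  have fa: "(f a, (f ^^ k) a) \<in> reach A ?Rg"
    if "0 < k" "\<And>j. 0 < j \<Longrightarrow> j < k \<Longrightarrow> (f ^^ j) a \<noteq> a" for k
    using that
  proof (induction k)
    case 0
    then show ?case by simp
  next
    case (Suc k)
    show ?case
    proof (cases "k = 0")
      case True
      then show ?thesis using ab f(1) by (auto simp: reach_def)
    next
      case False
      then have IH: "(f a, (f ^^ k) a) \<in> reach A ?Rg" using Suc by auto
      have "(f ^^ k) a \<noteq> a" using Suc.prems False by auto
      moreover have "(f ^^ k) a \<noteq> b"
        using diff False unfolding orbit_altdef by auto
      ultimately have "?g ((f ^^ k) a) = (f ^^ Suc k) a" by simp
      moreover have kA: "(f ^^ k) a \<in> A" using IH by (auto simp: reach_def)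
      ultimately have "((f ^^ k) a, (f ^^ Suc k) a) \<in> ?Rg" by force
      then have "((f ^^ k) a, (f ^^ Suc k) a) \<in> reach A ?Rg"
        using kA f(1) by (intro reach_edge) auto
      with IH show ?thesis by (rule reach_trans)
    qed
  qed
  have "a \<in> orbit f a" using self_in_orbit_finite fin f ab(1) by metis
  then have ex: "\<exists>n. 0 < n \<and> (f ^^ n) a = a" by (auto simp: orbit_altdef dest: sym)
  define m where "m = (LEAST n. 0 < n \<and> (f ^^ n) a = a)"
  have m: "0 < m" "(f ^^ m) a = a" using LeastI_ex[OF ex] unfolding m_def by auto
  have "(f ^^ j) a \<noteq> a" if "0 < j" "j < m" for j
    using that not_less_Least unfolding m_def by blast
  then have fa_a: "(f a, a) \<in> reach A ?Rg" using fa[OF m(1)] m(2) by simp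
  have g_reach: "(x, ?g x) \<in> reach A ?Rg" if "x \<in> A" for x
    using that gA by (intro reach_edge) auto
  \<comment> \<open>The composed map sends \<open>b\<close> to \<open>f a\<close>, from where the
    old cycle leads on to \<open>a\<close>: this links the two cycles.\<close>
  have "(b, f a) \<in> reach A ?Rg" using g_reach[OF ab(2)] by simp
  from this fa_a have ba: "(b, a) \<in> reach A ?Rg" by (rule reach_trans)
  have Rab: "insert (a, b) ?Rf \<subseteq> A \<times> A" using RA ab by auto
  have E: "reach A ?Rg = reach A (insert (a, b) ?Rf)"
  proof
    have f_reach: "(x, f x) \<in> reach A (insert (a, b) ?Rf)" if "x \<in> A" for x
      using that f(1) by (intro reach_edge) auto
    have ab': "(a, b) \<in> reach A (insert (a, b) ?Rf)" using ab by (intro reach_edge) auto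
    have "(x, ?g x) \<in> reach A (insert (a, b) ?Rf)" if "x \<in> A" for x
    proof -
      have "(x, transpose a b x) \<in> reach A (insert (a, b) ?Rf)"
        using ab' reach_sym[OF ab'] that by (auto simp: transpose_def reach_def)
      moreover have "transpose a b x \<in> A" using that tA by auto
      ultimately show ?thesis using f_reach[of "transpose a b x"] by (auto intro: reach_trans)
    qed
    then show "reach A ?Rg \<subseteq> reach A (insert (a, b) ?Rf)"
      by (intro reach_least[OF RA(2) reach_equiv]) auto
    have "(x, f x) \<in> reach A ?Rg" if "x \<in> A" for x
    proof -
      have "transpose a b x \<in> A" using that tA by auto
      from g_reach[OF this] have "(transpose a b x, f x) \<in> reach A ?Rg" by simp
      moreover have "(x, transpose a b x) \<in> reach A ?Rg"
        using ba reach_sym[OF ba] that by (auto simp: transpose_def reach_def)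
      ultimately show ?thesis by (blast intro: reach_trans)
    qed
    then show "reach A (insert (a, b) ?Rf) \<subseteq> reach A ?Rg"
      using reach_sym[OF ba] by (intro reach_least[OF Rab reach_equiv]) auto
  qed
  have "(a, b) \<notin> reach A ?Rf"
    using diff orbit_eq_reach[OF fin f ab(1)] by auto
  from card_quotient_reach_insert[OF fin RA(1) ab this] show ?thesis
    using orbits_eq_quotient[OF fin f] orbits_eq_quotient[OF fin gA ginj] E by simp
qed

section \<open>Bridges\<close>

text \<open>The dart \<open>h\<close> may lie outside \<open>S\<close>; then the edge about to be
  added is the only one across the cut. In this form subsets of \<open>S\<close> and preimages of
  \<open>A\<close> inherit the certificate.\<close>

definition is_bridge :: "('h \<Rightarrow> 'v) \<Rightarrow> ('h \<Rightarrow> 'h) \<Rightarrow> 'h set \<Rightarrow> 'h \<Rightarrow> bool" where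
  "is_bridge \<alpha> \<theta> S h \<longleftrightarrow> (\<exists>A. \<alpha> h \<in> A \<and> \<alpha> (\<theta> h) \<notin> A \<and>
     (\<forall>k\<in>S - {h, \<theta> h}. \<alpha> k \<in> A \<longleftrightarrow> \<alpha> (\<theta> k) \<in> A))"

lemma is_bridge_mono: "is_bridge \<alpha> \<theta> S h \<Longrightarrow> S' \<subseteq> S \<Longrightarrow> is_bridge \<alpha> \<theta> S' h"
  unfolding is_bridge_def by blast

text \<open>The complement of the cut serves for the reverse dart.\<close>

lemma is_bridge_flip: "is_bridge \<alpha> \<theta> S h \<Longrightarrow> \<theta> (\<theta> h) = h \<Longrightarrow> is_bridge \<alpha> \<theta> S (\<theta> h)"
  unfolding is_bridge_def by (metis Compl_iff insert_commute)

text \<open>\<open>N\<close> will count faces or components. Edges are taken out of \<open>S\<close>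
  one at a time, and those left remain bridges. Each edge lowers \<open>N\<close> by one but
  consists of two darts, hence the factors 2.\<close>

lemma bridges_count:
  fixes N :: "'h set \<Rightarrow> nat"
  assumes "finite S" "S0 \<subseteq> S"
    and inv: "\<And>h. h \<in> S \<Longrightarrow> \<theta> h \<in> S \<and> \<theta> (\<theta> h) = h \<and> \<theta> h \<noteq> h"
    and inv0: "\<And>h. h \<in> S0 \<Longrightarrow> \<theta> h \<in> S0"
    and bridge: "\<And>h. h \<in> S - S0 \<Longrightarrow> is_bridge \<alpha> \<theta> S h"
    and step: "\<And>X h. X \<subseteq> S \<Longrightarrow> \<theta> ` X \<subseteq> X \<Longrightarrow> h \<in> S - X \<Longrightarrow> is_bridge \<alpha> \<theta> X h \<Longrightarrow>
       N X = Suc (N (insert h (insert (\<theta> h) X)))"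
  shows "2 * N S + card (S - S0) = 2 * N S0"
  using assms
proof (induction "card (S - S0)" arbitrary: S rule: less_induct)
  case (less S)
  show ?case
  proof (cases "S = S0")
    case True
    then show ?thesis by simp
  next
    case False
    then obtain h where h: "h \<in> S" "h \<notin> S0" using less.prems(2) by auto
    have th: "\<theta> h \<in> S" "\<theta> (\<theta> h) = h" "\<theta> h \<noteq> h" using less.prems(3) h by auto
    have th0: "\<theta> h \<notin> S0" using less.prems(4)[of "\<theta> h"] th h by auto
    let ?S = "S - {h, \<theta> h}"
    have inv': "\<theta> k \<in> ?S \<and> \<theta> (\<theta> k) = k \<and> \<theta> k \<noteq> k" if "k \<in> ?S" for k
      using that less.prems(3)[of k] th by auto
    have c: "card (S - S0) = Suc (Suc (card (?S - S0)))"
    proof -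
      have "S - S0 = insert h (insert (\<theta> h) (?S - S0))" using h th th0 by auto
      moreover have "h \<notin> insert (\<theta> h) (?S - S0)" "\<theta> h \<notin> ?S - S0" using th by auto
      moreover have "finite (?S - S0)" using less.prems(1) by auto
      ultimately show ?thesis by (metis card_insert_disjoint finite_insert)
    qed
    have "2 * N ?S + card (?S - S0) = 2 * N S0"
    proof (rule less.hyps)
      show "card (?S - S0) < card (S - S0)" using c by simp
      show "finite ?S" "S0 \<subseteq> ?S" using less.prems(1,2) h th0 by auto
      show "\<theta> k \<in> ?S \<and> \<theta> (\<theta> k) = k \<and> \<theta> k \<noteq> k" if "k \<in> ?S" for k by (rule inv'[OF that])
      show "\<theta> k \<in> S0" if "k \<in> S0" for k using less.prems(4) that .
      show "is_bridge \<alpha> \<theta> ?S k" if "k \<in> ?S - S0" for k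
        using less.prems(5)[of k] that by (auto intro: is_bridge_mono)
      show "N X = Suc (N (insert k (insert (\<theta> k) X)))"
        if "X \<subseteq> ?S" "\<theta> ` X \<subseteq> X" "k \<in> ?S - X" "is_bridge \<alpha> \<theta> X k" for X k
        using less.prems(6)[of X k] that by auto
    qed
    moreover have "N ?S = Suc (N (insert h (insert (\<theta> h) ?S)))"
    proof (rule less.prems(6))
      show "\<theta> ` ?S \<subseteq> ?S" using inv' by auto
      show "is_bridge \<alpha> \<theta> ?S h"
        using less.prems(5)[of h] h by (auto intro: is_bridge_mono)
    qed (use h in auto)
    moreover have "insert h (insert (\<theta> h) ?S) = S" using h th by auto
    ultimately show ?thesis using c by simp
  qed
qed

section \<open>Faces of submaps\<close>

definition partial_flip :: "('h \<Rightarrow> 'h) \<Rightarrow> 'h set \<Rightarrow> 'h \<Rightarrow> 'h" where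
  "partial_flip \<theta> S h = (if h \<in> S then \<theta> h else h)"

lemma
  assumes "wf_map M" and "h \<in> darts M"
  shows rot_in_darts: "rot M h \<in> darts M"
    and att_rot: "att M (rot M h) = att M h"
    and self_in_orbit_rot: "h \<in> orbit (rot M) h"
proof -
  have o: "orbit (rot M) h = {h' \<in> darts M. att M h' = att M h}"
    using assms by (simp add: wf_map_def)
  then show "rot M h \<in> darts M" "att M (rot M h) = att M h"
    using orbit.base[of "rot M" h] by auto
  show "h \<in> orbit (rot M) h"
    using o assms(2) by simp
qed

text \<open>\<open>wf_map\<close> prescribes only the orbits. On a finite orbit \<open>rot M\<close>
  is onto, hence injective, and darts of different vertices have images at different
  vertices.\<close>

lemma inj_on_rot:
  assumes "wf_map M"
  shows "inj_on (rot M) (darts M)"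
proof (rule inj_onI)
  fix a b assume ab: "a \<in> darts M" "b \<in> darts M" "rot M a = rot M b"
  let ?O = "orbit (rot M) a"
  have O: "?O = {h' \<in> darts M. att M h' = att M a}"
    using assms ab(1) by (simp add: wf_map_def)
  have "att M a = att M b"
    using ab att_rot[OF assms] by metis
  then have "a \<in> ?O" "b \<in> ?O" using O ab by auto
  have "finite ?O" using O assms by (simp add: wf_map_def wf_graph_def)
  moreover have "rot M ` ?O = ?O"
  proof
    show "rot M ` ?O \<subseteq> ?O" by (auto intro: orbit.step)
    show "?O \<subseteq> rot M ` ?O"
    proof
      fix y assume "y \<in> ?O"
      then show "y \<in> rot M ` ?O" by cases (use \<open>a \<in> ?O\<close> in auto)
    qed
  qed
  ultimately have "inj_on (rot M) ?O"
    by (simp add: eq_card_imp_inj_on)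
  then show "a = b"
    using ab(3) \<open>a \<in> ?O\<close> \<open>b \<in> ?O\<close> by (auto dest: inj_onD)
qed

context
  fixes M :: "('v, 'h, 'z) colored_map_scheme" and S :: "'h set"
  assumes wf: "wf_map M" and S: "S \<subseteq> darts M" "flip M ` S \<subseteq> S"
begin

lemma face_perm_in_darts: "(rot M \<circ> partial_flip (flip M) S) ` darts M \<subseteq> darts M"
proof -
  have "flip M h \<in> darts M" if "h \<in> S" for h using that S by auto
  then show ?thesis using rot_in_darts[OF wf] by (auto simp: partial_flip_def)
qed

lemma inj_on_face_perm: "inj_on (rot M \<circ> partial_flip (flip M) S) (darts M)"
proof (rule comp_inj_on)
  have "flip M (flip M h) = h" if "h \<in> darts M" for h
    using that wf by (auto simp: wf_map_def wf_graph_def)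
  then have "partial_flip (flip M) S (partial_flip (flip M) S h) = h" if "h \<in> darts M" for h
    using that S by (auto simp: partial_flip_def)
  then show "inj_on (partial_flip (flip M) S) (darts M)"
    by (rule inj_on_inverseI)
  show "inj_on (rot M) (partial_flip (flip M) S ` darts M)"
    by (rule inj_on_subset[OF inj_on_rot[OF wf]]) (use S in \<open>auto simp: partial_flip_def\<close>)
qed

lemma self_in_face: "h \<in> darts M \<Longrightarrow> h \<in> orbit (rot M \<circ> partial_flip (flip M) S) h"
  using self_in_orbit_finite[OF _ face_perm_in_darts inj_on_face_perm] wf
  by (simp add: wf_map_def wf_graph_def)

end

section \<open>First-return maps\<close>

lemma first_return_least:
  assumes "0 < n" "(f ^^ n) x \<in> S" "\<And>j. 0 < j \<Longrightarrow> j < n \<Longrightarrow> (f ^^ j) x \<notin> S"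
  shows "first_return f S x = (f ^^ n) x"
proof -
  have "(LEAST n. 0 < n \<and> (f ^^ n) x \<in> S) = n"
    by (rule Least_equality) (use assms not_le in blast)+
  then show ?thesis by (simp add: first_return_def)
qed

lemma first_return_funpow:
  assumes "y \<in> orbit f x" "y \<in> S"
  shows "\<exists>n. 0 < n \<and> (f ^^ n) x \<in> S \<and> (\<forall>j. 0 < j \<and> j < n \<longrightarrow> (f ^^ j) x \<notin> S)
    \<and> first_return f S x = (f ^^ n) x"
proof -
  have ex: "\<exists>n. 0 < n \<and> (f ^^ n) x \<in> S"
    using assms by (auto simp: orbit_altdef)
  define n where "n = (LEAST n. 0 < n \<and> (f ^^ n) x \<in> S)"
  have "0 < n" "(f ^^ n) x \<in> S"
    using LeastI_ex[OF ex] by (auto simp: n_def)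
  moreover have "(f ^^ j) x \<notin> S" if "0 < j" "j < n" for j
    using that not_less_Least unfolding n_def by blast
  moreover have "first_return f S x = (f ^^ n) x"
    by (simp add: first_return_def n_def)
  ultimately show ?thesis by blast
qed

lemma first_return_in:
  assumes "y \<in> orbit f x" "y \<in> S"
  shows "first_return f S x \<in> orbit f x \<inter> S"
  using first_return_funpow[OF assms] by (auto simp: orbit_altdef)

text \<open>The return map lists the visits to \<open>S\<close> in the order in which
  \<open>f\<close> makes them. Recurrence ensures that a first return exists; the harder inclusion
  strips it off and recurses on the number of steps left.\<close>

lemma orbit_first_return:
  assumes rec: "\<And>x. x \<in> S \<Longrightarrow> x \<in> orbit f x" and "x \<in> S"
  shows "orbit (first_return f S) x = orbit f x \<inter> S"
proof (intro set_eqI iffI)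
  have fr: "first_return f S z \<in> orbit f z \<inter> S" if "z \<in> S" for z
    by (rule first_return_in[OF rec[OF that] that])
  fix y
  {
    assume "y \<in> orbit (first_return f S) x"
    then show "y \<in> orbit f x \<inter> S"
    proof induction
      case base
      then show ?case using fr assms(2) by blast
    next
      case (step y)
      then show ?case using fr[of y] by (blast intro: orbit_trans)
    qed
  }
  assume "y \<in> orbit f x \<inter> S"
  then obtain n where "0 < n" "y = (f ^^ n) x" "y \<in> S" by (auto simp: orbit_altdef)
  then show "y \<in> orbit (first_return f S) x"
    using \<open>x \<in> S\<close>
  proof (induction n arbitrary: x rule: less_induct)
    case (less n x)
    have y: "y \<in> orbit f x" using less.prems by (auto simp: orbit_altdef)
    obtain m where m: "0 < m" "(f ^^ m) x \<in> S" "\<And>j. 0 < j \<Longrightarrow> j < m \<Longrightarrow> (f ^^ j) x \<notin> S"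
      "first_return f S x = (f ^^ m) x"
      using first_return_funpow[OF y less.prems(3)] by blast
    have "\<not> n < m" using m(3)[of n] less.prems(1-3) by blast
    then consider "m = n" | "m < n" by linarith
    then show ?case
    proof cases
      case 1
      then show ?thesis using m(4) less.prems(2) orbit.base[of "first_return f S" x] by simp
    next
      case 2
      then have "y = (f ^^ (n - m)) (first_return f S x)"
        using less.prems(2) m(4) funpow_add[of "n - m" m f] by simp
      then have "y \<in> orbit (first_return f S) (first_return f S x)"
        using less.IH[of "n - m" "first_return f S x"] 2 m less.prems by auto
      then show ?thesis by (rule orbit_subset)
    qed
  qed
qed

text \<open>
  Turning the edges outside \<open>S\<close> into pairs of cilia, instead of deleting them, changes neither
  the faces nor the isolated vertices, but keeps the set of darts fixed.
\<close>

lemma num_faces_submap: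
  fixes M :: "('v, 'h, 'z) colored_map_scheme"
  assumes wf: "wf_map M" and S: "S \<subseteq> darts M" "flip M ` S \<subseteq> S"
  shows "num_faces (M\<lparr>darts := S, rot := first_return (rot M) S\<rparr>) =
    card (orbit (rot M \<circ> partial_flip (flip M) S) ` darts M) + card (verts M - att M ` darts M)"
proof -
  let ?f = "rot M \<circ> partial_flip (flip M) S"
  let ?\<psi> = "\<lambda>h. first_return (rot M) S (flip M h)"
  note self = self_in_face[OF wf S]
  have fin: "finite (verts M)" "finite (darts M)" "att M ` darts M \<subseteq> verts M"
    using wf by (auto simp: wf_map_def wf_graph_def)
  \<comment> \<open>After the flip both walks turn around the same vertex: until the next dart of
    \<open>S\<close> is met, \<open>?f\<close> acts as \<open>rot M\<close>. So faces of the submap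
    are first-return orbits of \<open>?f\<close>.\<close>
  have \<psi>: "?\<psi> h = first_return ?f S h" if "h \<in> S" for h
  proof -
    have "flip M h \<in> S" using that S by auto
    then have "flip M h \<in> darts M" using S by auto
    from self_in_orbit_rot[OF wf this] \<open>flip M h \<in> S\<close>
    obtain n where n: "0 < n" "(rot M ^^ n) (flip M h) \<in> S"
      "\<And>j. 0 < j \<Longrightarrow> j < n \<Longrightarrow> (rot M ^^ j) (flip M h) \<notin> S" "?\<psi> h = (rot M ^^ n) (flip M h)"
      using first_return_funpow[of "flip M h" "rot M" "flip M h" S] by blast
    have eq: "(?f ^^ k) h = (rot M ^^ k) (flip M h)" if "0 < k" "k \<le> n" for k
      using that
    proof (induction k)
      case 0
      then show ?case by simp
    next
      case (Suc k)
      show ?case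
      proof (cases "k = 0")
        case True
        then show ?thesis using \<open>h \<in> S\<close> by (simp add: partial_flip_def)
      next
        case False
        then show ?thesis using Suc n(3)[of k] by (simp add: partial_flip_def)
      qed
    qed
    have "first_return ?f S h = (?f ^^ n) h"
      by (rule first_return_least) (use n eq in auto)
    then show ?thesis using n eq by simp
  qed
  have maps: "?\<psi> h \<in> S" if "h \<in> S" for h
    using \<psi>[OF that] first_return_in[OF self that] that S by auto
  have orb: "orbit ?\<psi> h = orbit ?f h \<inter> S" if "h \<in> S" for h
  proof -
    have "orbit ?\<psi> h = orbit (first_return ?f S) h"
      by (rule orbit_cong0[OF that]) (use maps \<psi> in auto)
    also have "\<dots> = orbit ?f h \<inter> S"
      by (rule orbit_first_return) (use self S that in auto)
    finally show ?thesis .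
  qed
  have cls: "orbit ?f a = orbit ?f b" if "b \<in> orbit ?f a" "a \<in> darts M" for a b
  proof -
    have "a \<in> orbit ?f b" using orbit_swap[OF self[OF that(2)] that(1)] .
    then show ?thesis using that(1) orbit_trans by fast
  qed
  have "orbit ?\<psi> ` S = (\<lambda>Z. Z \<inter> S) ` (orbit ?f ` S)"
    using orb by (auto simp: image_image)
  moreover have "inj_on (\<lambda>Z. Z \<inter> S) (orbit ?f ` S)"
  proof (rule inj_onI, clarify)
    fix a b assume ab: "a \<in> S" "b \<in> S" "orbit ?f a \<inter> S = orbit ?f b \<inter> S"
    then have "a \<in> orbit ?f b" using self[of a] S by auto
    then show "orbit ?f a = orbit ?f b" using cls ab S by blast
  qed
  ultimately have c1: "card (orbit ?\<psi> ` S) = card (orbit ?f ` S)"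
    by (simp add: card_image)
  \<comment> \<open>These darts sit at vertices that lose all their darts. Such a vertex is a single
    orbit of \<open>?f\<close>, and in the submap it is isolated, which \<open>num_faces\<close>
    counts as one face.\<close>
  let ?X = "{h \<in> darts M. att M h \<notin> att M ` S}"
  have rot_orb: "orbit (rot M) h = {h' \<in> darts M. att M h' = att M h}" if "h \<in> darts M" for h
    using that wf by (simp add: wf_map_def)
  have orbX: "orbit ?f h = {h' \<in> darts M. att M h' = att M h}" if "h \<in> ?X" for h
  proof -
    have "orbit ?f h = orbit (rot M) h"
    proof (rule orbit_cong)
      show "h \<in> orbit (rot M) h" using self_in_orbit_rot[OF wf] that by auto
      show "?f s = rot M s" if "s \<in> orbit (rot M) h" for s
        using that rot_orb[of h] \<open>h \<in> ?X\<close> by (auto simp: partial_flip_def image_iff)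
    qed
    then show ?thesis using rot_orb that by auto
  qed
  \<comment> \<open>An orbit that avoids \<open>S\<close> never flips, so it is a full turn around a
    vertex without darts in \<open>S\<close>.\<close>
  have XS: "orbit ?f h \<inter> S \<noteq> {} \<or> h \<in> ?X" if "h \<in> darts M" for h
  proof (rule ccontr)
    assume neg: "\<not> ?thesis"
    have "orbit (rot M) h = orbit ?f h"
      by (rule orbit_cong[OF self[OF that]]) (use neg in \<open>auto simp: partial_flip_def\<close>)
    then show False using neg rot_orb[OF that] that S by force
  qed
  have "orbit ?f ` darts M = orbit ?f ` S \<union> orbit ?f ` ?X"
  proof (intro equalityI subsetI)
    fix X assume "X \<in> orbit ?f ` darts M"
    then obtain h where h: "h \<in> darts M" "X = orbit ?f h" by auto
    from XS[OF h(1)] show "X \<in> orbit ?f ` S \<union> orbit ?f ` ?X"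
      using cls[OF _ h(1)] h by blast
  qed (use S in auto)
  moreover have "orbit ?f ` S \<inter> orbit ?f ` ?X = {}"
  proof -
    have "orbit ?f a \<noteq> orbit ?f b" if "a \<in> S" "b \<in> ?X" for a b
    proof
      assume "orbit ?f a = orbit ?f b"
      then have "att M a = att M b" using self[of a] orbX[OF that(2)] that(1) S(1) by auto
      then show False using that by (metis (mono_tags, lifting) imageI mem_Collect_eq)
    qed
    then show ?thesis by blast
  qed
  moreover have "finite ?X" "finite S" using fin S finite_subset by auto
  ultimately have c2: "card (orbit ?f ` darts M) = card (orbit ?f ` S) + card (orbit ?f ` ?X)"
    by (simp add: card_Un_disjoint)
  have "orbit ?f ` ?X = (\<lambda>v. {h' \<in> darts M. att M h' = v}) ` (att M ` ?X)"
    using orbX by (auto simp: image_image)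
  moreover have "inj_on (\<lambda>v. {h' \<in> darts M. att M h' = v}) (att M ` ?X)"
    by (rule inj_onI) auto
  ultimately have c3: "card (orbit ?f ` ?X) = card (att M ` ?X)"
    by (simp add: card_image)
  have "att M ` S \<subseteq> att M ` darts M" using S by auto
  moreover have "att M ` ?X = att M ` darts M - att M ` S" by (auto simp: image_iff)
  ultimately have "verts M - att M ` S = att M ` ?X \<union> (verts M - att M ` darts M)"
    using fin(3) by blast
  moreover have "att M ` ?X \<inter> (verts M - att M ` darts M) = {}" by auto
  ultimately have c4: "card (verts M - att M ` S) = card (att M ` ?X) + card (verts M - att M ` darts M)"
    using fin \<open>finite ?X\<close> by (simp add: card_Un_disjoint)
  show ?thesis using c1 c2 c3 c4 by (simp add: num_faces_def)
qed

text \<open>A face walk changes its vertex only along edges of \<open>X\<close>, none of which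
  crosses the cut, so the walk from \<open>h\<close> never reaches \<open>flip M h\<close>: the new
  edge joins two different faces.\<close>

lemma orbits_face_perm_bridge:
  assumes wf: "wf_map M" and X: "X \<subseteq> darts M" "flip M ` X \<subseteq> X"
    and h: "h \<in> darts M - X" and bridge: "is_bridge (att M) (flip M) X h"
  shows "card (orbit (rot M \<circ> partial_flip (flip M) X) ` darts M) =
    Suc (card (orbit (rot M \<circ> partial_flip (flip M) (insert h (insert (flip M h) X))) ` darts M))"
proof -
  let ?f = "rot M \<circ> partial_flip (flip M) X"
  have fl: "flip M k \<in> darts M" "flip M (flip M k) = k" if "k \<in> darts M" for k
    using that wf by (auto simp: wf_map_def wf_graph_def)
  have fh: "flip M h \<in> darts M - X" using fl[of h] h X by (metis DiffD1 DiffD2 DiffI imageI subsetD)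
  \<comment> \<open>The two darts are fixed by the old partial flip and exchanged by the new one, so
    switching the edge on is composition with a transposition.\<close>
  have "rot M \<circ> partial_flip (flip M) (insert h (insert (flip M h) X)) = ?f \<circ> transpose h (flip M h)"
    using h fh fl(2)[of h] by (auto simp: fun_eq_iff partial_flip_def transpose_def)
  moreover have "flip M h \<notin> orbit ?f h"
  proof
    from bridge obtain A where A: "att M h \<in> A" "att M (flip M h) \<notin> A"
      "\<And>k. k \<in> X - {h, flip M h} \<Longrightarrow> att M k \<in> A \<longleftrightarrow> att M (flip M k) \<in> A"
      by (auto simp: is_bridge_def)
    have step: "att M (?f k) \<in> A \<and> ?f k \<in> darts M" if "k \<in> darts M" "att M k \<in> A" for k
    proof (cases "k \<in> X")
      case True
      then have "k \<in> X - {h, flip M h}" using h fh by auto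
      then show ?thesis
        using A(3)[of k] that fl(1)[of k] True by (simp add: partial_flip_def att_rot[OF wf] rot_in_darts[OF wf])
    next
      case False
      then show ?thesis using that by (simp add: partial_flip_def att_rot[OF wf] rot_in_darts[OF wf])
    qed
    assume "flip M h \<in> orbit ?f h"
    then have "att M (flip M h) \<in> A \<and> flip M h \<in> darts M"
      by induction (use step A(1) h in blast)+
    with A(2) show False by simp
  qed
  ultimately show ?thesis
    using card_orbits_transpose[OF _ face_perm_in_darts[OF wf X] inj_on_face_perm[OF wf X], of h "flip M h"]
      h fh wf by (simp add: wf_map_def wf_graph_def)
qed

section \<open>Trees\<close>

lemma components_connected:
  assumes "connected_graph G"
  shows "components G = {verts G}"
  using assms unfolding connected_graph_def connected_by_def components_def component_of_def
  by (auto simp: reach_def image_iff)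

lemma quotient_reach_empty: "V // reach V {} = (\<lambda>v. {v}) ` V"
  by (auto simp: quotient_def reach_def)

text \<open>The start vertex must not recur, so that closing the path with one edge meets the
  distinctness demanded by \<open>graph_cycle\<close>.\<close>

fun simple_path :: "('v, 'h, 'z) graph_scheme \<Rightarrow> 'h set \<Rightarrow> 'h list \<Rightarrow> 'v \<Rightarrow> 'v \<Rightarrow> bool" where
  "simple_path G S [] u v \<longleftrightarrow> u = v"
| "simple_path G S (k # ks) u v \<longleftrightarrow> k \<in> S \<and> att G k = u \<and> u \<notin> set (map (att G) ks @ [v])
     \<and> simple_path G S ks (att G (flip G k)) v"

lemma simple_path_suffix:
  "simple_path G S ks u v \<Longrightarrow> w \<in> set (map (att G) ks @ [v]) \<Longrightarrow> \<exists>ls. simple_path G S ls w v"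
proof (induction ks arbitrary: u)
  case Nil
  then show ?case by (auto intro: exI[of _ "[]"])
next
  case (Cons k ks)
  show ?case
  proof (cases "w = u")
    case True
    then show ?thesis using Cons.prems(1) by blast
  next
    case False
    then show ?thesis using Cons by auto
  qed
qed

lemma simple_path_start: "simple_path G S ks u v \<Longrightarrow> u \<in> set (map (att G) ks @ [v])"
  by (cases ks) auto

text \<open>These are the clauses of \<open>graph_cycle\<close> in open form. Heads are tails
  shifted by one, which becomes \<open>rotate1\<close> once an edge from \<open>v\<close> to
  \<open>u\<close> is put in front. An edge used both ways would bring the path back to an earlier
  vertex.\<close>

lemma simple_path_props:
  assumes "simple_path G S ks u v" "\<And>h. h \<in> S \<Longrightarrow> flip G (flip G h) = h"
  shows "set ks \<subseteq> S" and "distinct (map (att G) ks @ [v])"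
    and "u # map (\<lambda>h. att G (flip G h)) ks = map (att G) ks @ [v]"
    and "\<forall>h\<in>set ks. flip G h \<notin> set ks"
proof -
  have *: "u # map (\<lambda>h. att G (flip G h)) ks = map (att G) ks @ [v]"
    if "simple_path G S ks u v" for u ks
    using that by (induction ks arbitrary: u) auto
  have sub: "set ks \<subseteq> S" if "simple_path G S ks u v" for u ks
    using that by (induction ks arbitrary: u) auto
  show "set ks \<subseteq> S" "u # map (\<lambda>h. att G (flip G h)) ks = map (att G) ks @ [v]"
    using * sub assms(1) by auto
  show "distinct (map (att G) ks @ [v])"
    using assms(1) by (induction ks arbitrary: u) auto
  show "\<forall>h\<in>set ks. flip G h \<notin> set ks"
    using assms(1)
  proof (induction ks arbitrary: u)
    case (Cons k ks)
    then have k: "k \<in> S" "att G k = u" "u \<notin> set (map (att G) ks @ [v])"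
      and p: "simple_path G S ks (att G (flip G k)) v" by auto
    have att: "att G h \<noteq> u" "att G (flip G h) \<noteq> u" if "h \<in> set ks" for h
    proof -
      show "att G h \<noteq> u" using that k(3) by (metis image_eqI set_map UnI1 set_append)
      have "att G (flip G h) \<in> set (att G (flip G k) # map (\<lambda>h. att G (flip G h)) ks)"
        using that by simp
      then show "att G (flip G h) \<noteq> u" using k(3) unfolding *[OF p] by metis
    qed
    have "flip G k \<notin> set ks"
      using att(2)[of "flip G k"] assms(2)[OF k(1)] k(2) by auto
    moreover have "flip G k \<noteq> k"
      using simple_path_start[OF p] k by auto
    moreover have "flip G h \<noteq> k" if "h \<in> set ks" for h
      using att(2)[OF that] k(2) by auto
    ultimately show ?case using Cons.IH[OF p] by auto
  qed simp
qed

lemma ex_simple_path: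
  assumes "(u, v) \<in> {(att G h, att G (flip G h)) | h. h \<in> S}\<^sup>*"
  shows "\<exists>ks. simple_path G S ks u v"
  using assms
proof (induction rule: converse_rtrancl_induct)
  case base
  show ?case by (auto intro: exI[of _ "[]"])
next
  case (step u w)
  then obtain k ks where k: "k \<in> S" "att G k = u" "att G (flip G k) = w" and p: "simple_path G S ks w v"
    by blast
  show ?case
  proof (cases "u \<in> set (map (att G) ks @ [v])")
    case True
    then show ?thesis using simple_path_suffix[OF p] by blast
  next
    case False
    then have "simple_path G S (k # ks) u v" using k p by simp
    then show ?thesis by blast
  qed
qed

text \<open>If the far end of \<open>h\<close> could return to the near end without this edge, a
  simple return path preceded by \<open>h\<close> would be a cycle.\<close>

lemma acyclic_is_bridge:
  assumes wf: "wf_graph G" and acyclic: "\<nexists>hs. graph_cycle G hs"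
    and h: "h \<in> darts G" and nofix: "\<And>k. k \<in> darts G \<Longrightarrow> flip G k \<noteq> k"
  shows "is_bridge (att G) (flip G) (darts G) h"
proof -
  let ?S = "darts G - {h, flip G h}" and ?u = "att G h" and ?v = "att G (flip G h)"
  let ?R = "{(att G h, att G (flip G h)) | h. h \<in> ?S}"
  have fl: "flip G k \<in> darts G" "flip G (flip G k) = k" if "k \<in> darts G" for k
    using that wf by (auto simp: wf_graph_def)
  have "(?v, ?u) \<notin> ?R\<^sup>*"
  proof
    assume "(?v, ?u) \<in> ?R\<^sup>*"
    from ex_simple_path[OF this] obtain ks where p: "simple_path G ?S ks ?v ?u" ..
    have inv: "flip G (flip G k) = k" if "k \<in> ?S" for k using fl that by auto
    note q = simple_path_props[OF p inv]
    have "graph_cycle G (h # ks)"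
      unfolding graph_cycle_def
    proof (intro conjI)
      show "\<forall>k\<in>set (h # ks). k \<in> darts G \<and> flip G k \<noteq> k" using q(1) h nofix by auto
      show "distinct (map (att G) (h # ks))" using q(2) by auto
      show "map (\<lambda>h. att G (flip G h)) (h # ks) = rotate1 (map (att G) (h # ks))"
        using q(3) by simp
      have "flip G k \<noteq> h" if "k \<in> set ks" for k
        using q(1) that fl(2)[of k] by auto
      then show "\<forall>k\<in>set (h # ks). flip G k \<notin> set (h # ks)"
        using q(1,4) nofix[OF h] by auto
    qed simp
    then show False using acyclic by blast
  qed
  \<comment> \<open>The side of the near end once the edge is removed. The remaining darts are
    closed under \<open>flip G\<close>, so directed reachability is symmetric and no other edge
    crosses.\<close>
  define A where "A = {x. (x, ?u) \<in> ?R\<^sup>*}"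
  have "att G k \<in> A \<longleftrightarrow> att G (flip G k) \<in> A" if k: "k \<in> ?S" for k
  proof -
    have "flip G k \<in> ?S" using k fl[of k] fl(2)[OF h] by auto
    then have "(att G (flip G k), att G (flip G (flip G k))) \<in> ?R" by blast
    then have "(att G (flip G k), att G k) \<in> ?R" using fl(2)[of k] k by simp
    moreover have "(att G k, att G (flip G k)) \<in> ?R" using k by blast
    ultimately show ?thesis unfolding A_def by (blast intro: converse_rtrancl_into_rtrancl)
  qed
  moreover have "?u \<in> A" "?v \<notin> A" using \<open>(?v, ?u) \<notin> ?R\<^sup>*\<close> by (auto simp: A_def)
  ultimately show ?thesis unfolding is_bridge_def by blast
qed

text \<open>Here \<open>bridges_count\<close> counts components: switching on the edges joins the
  isolated vertices into one class, one merger per edge.\<close>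

lemma tree_card_darts:
  assumes tree: "is_tree G" and wf: "wf_graph G" and nofix: "\<And>h. h \<in> darts G \<Longrightarrow> flip G h \<noteq> h"
  shows "2 + card (darts G) = 2 * card (verts G)"
proof -
  let ?R = "\<lambda>X. {(att G h, att G (flip G h)) | h. h \<in> X}"
  let ?N = "\<lambda>X. card (verts G // reach (verts G) (?R X))"
  have fin: "finite (verts G)" "finite (darts G)" "att G ` darts G \<subseteq> verts G"
    and fl: "\<And>h. h \<in> darts G \<Longrightarrow> flip G h \<in> darts G \<and> flip G (flip G h) = h"
    using wf by (auto simp: wf_graph_def)
  have "2 * ?N (darts G) + card (darts G - {}) = 2 * ?N {}"
  proof (rule bridges_count[where \<theta> = "flip G" and \<alpha> = "att G"])
    show "flip G h \<in> darts G \<and> flip G (flip G h) = h \<and> flip G h \<noteq> h" if "h \<in> darts G" for h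
      using that fl nofix by auto
    show "is_bridge (att G) (flip G) (darts G) h" if "h \<in> darts G - {}" for h
      using acyclic_is_bridge[OF wf] tree that nofix by (auto simp: is_tree_def)
    fix X h assume X: "X \<subseteq> darts G" "flip G ` X \<subseteq> X" and h: "h \<in> darts G - X"
      and b: "is_bridge (att G) (flip G) X h"
    let ?u = "att G h" and ?v = "att G (flip G h)"
    have fh: "flip G h \<notin> X" using fl[of h] h X(2) by (metis DiffD1 DiffD2 imageI subsetD)
    have RV: "?R X \<subseteq> verts G \<times> verts G" using X fin fl by blast
    have uv: "?u \<in> verts G" "?v \<in> verts G" using h fin fl by auto
    from b obtain A where A: "?u \<in> A" "?v \<notin> A"
      "\<And>k. k \<in> X - {h, flip G h} \<Longrightarrow> att G k \<in> A \<longleftrightarrow> att G (flip G k) \<in> A"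
      by (auto simp: is_bridge_def)
    have "(?u, ?v) \<notin> reach (verts G) (?R X)"
    proof
      assume "(?u, ?v) \<in> reach (verts G) (?R X)"
      then have "?u \<in> A \<longleftrightarrow> ?v \<in> A"
        by (rule reach_invariant) (use A(3) h fh in blast)
      with A show False by simp
    qed
    note card_quotient_reach_insert[OF fin(1) RV uv this]
    moreover have "?R (insert h (insert (flip G h) X)) = insert (?v, ?u) (insert (?u, ?v) (?R X))"
      using fl[of h] h by (auto simp: insert_commute)
    \<comment> \<open>The reverse dart adds nothing, because \<open>reach\<close> symmetrizes its
      relation.\<close>
    moreover have "reach (verts G) (insert (?v, ?u) (insert (?u, ?v) (?R X))) =
        reach (verts G) (insert (?u, ?v) (?R X))"
    proof -
      have "insert (b, a) (insert (a, b) R) \<union> (insert (b, a) (insert (a, b) R))\<inverse> =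
        insert (a, b) R \<union> (insert (a, b) R)\<inverse>" for a b :: 'a and R by auto
      then show ?thesis by (simp only: reach_def)
    qed
    ultimately show "?N X = Suc (?N (insert h (insert (flip G h) X)))" by simp
  qed (use fin in auto)
  moreover have "?N (darts G) = 1"
    using components_connected[of G] tree unfolding components_quotient adj_def is_tree_def by simp
  moreover have "?N {} = card (verts G)"
    by (simp add: quotient_reach_empty card_image)
  ultimately show ?thesis by simp
qed

section \<open>Connected components\<close>

lemma component_of_eq:
  assumes "C \<in> components G" "x \<in> C"
  shows "C = component_of G x"
  using assms unfolding components_def component_of_def
  by (auto intro: reach_trans reach_sym)

lemma component_of_self: "x \<in> verts G \<Longrightarrow> x \<in> component_of G x"
  by (auto simp: component_of_def reach_def)

lemma component_of_in: "x \<in> verts G \<Longrightarrow> component_of G x \<in> components G"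
  by (auto simp: components_def)

lemma component_of_adj:
  "(x, y) \<in> adj G \<Longrightarrow> x \<in> verts G \<Longrightarrow> y \<in> verts G \<Longrightarrow> component_of G x = component_of G y"
  using eq_equiv_class_iff[OF reach_equiv, of x "verts G" y "adj G"]
  unfolding component_of_def by (auto intro: reach_edge)

lemma component_closed:
  assumes "C \<in> components G" "(x, y) \<in> adj G" "x \<in> verts G" "y \<in> verts G"
  shows "x \<in> C \<longleftrightarrow> y \<in> C"
  using component_of_adj[OF assms(2-4)] component_of_eq[OF assms(1)] component_of_self assms(3,4)
  by metis

section \<open>Monochromatic edges of a reduced map\<close>

text \<open>
  The witness is the segment of the permutation that runs from the target of \<open>e0\<close> to the source
  of \<open>e1\<close>.
\<close>

lemma permutation_segment:
  assumes \<sigma>: "finite \<Omega>" "\<sigma> ` \<Omega> \<subseteq> \<Omega>" "inj_on \<sigma> \<Omega>"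
    and E: "\<And>e. e \<in> E \<Longrightarrow> s e \<in> \<Omega> \<and> \<sigma> (s e) = t e" and inj: "inj_on s E"
    and e01: "e0 \<in> E" "e1 \<in> E" "e0 \<noteq> e1" and orb: "s e1 \<in> orbit \<sigma> (t e0)"
  shows "\<exists>A. s e1 \<in> A \<and> t e1 \<notin> A \<and> (\<forall>e\<in>E - {e0, e1}. s e \<in> A \<longleftrightarrow> t e \<in> A)"
proof -
  let ?y = "t e0"
  have y: "?y \<in> \<Omega>" using E[OF e01(1)] \<sigma>(2) by auto
  have pow: "(\<sigma> ^^ k) ?y \<in> \<Omega>" for k
    by (induction k) (use y \<sigma>(2) in auto)
  have t_inj: "e = e'" if "e \<in> E" "e' \<in> E" "t e = t e'" for e e'
  proof -
    have "s e = s e'" using that E \<sigma>(3) by (metis inj_onD)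
    then show ?thesis using that inj by (auto dest: inj_onD)
  qed
  \<comment> \<open>Walking an edge backwards stays inside the segment, except along
    \<open>e0\<close>, whose target is where the segment starts.\<close>
  have pred: "k \<noteq> 0 \<and> s e = (\<sigma> ^^ (k - 1)) ?y" if "e \<in> E" "e \<noteq> e0" "t e = (\<sigma> ^^ k) ?y" for e k
  proof (cases k)
    case 0
    then show ?thesis using that t_inj[of e e0] e01 by simp
  next
    case (Suc j)
    then have "\<sigma> (s e) = \<sigma> ((\<sigma> ^^ j) ?y)" using that E by simp
    then have "s e = (\<sigma> ^^ j) ?y" by (rule inj_onD[OF \<sigma>(3)]) (use pow E that(1) in auto)
    then show ?thesis using Suc by simp
  qed
  have ex: "\<exists>n. (\<sigma> ^^ n) ?y = s e1" using orb by (auto simp: orbit_altdef)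
  \<comment> \<open>The segment ends at the first visit to the source of \<open>e1\<close>. Hence it
    misses the target of \<open>e1\<close>: one step back would be an earlier visit.\<close>
  define m where "m = (LEAST n. (\<sigma> ^^ n) ?y = s e1)"
  have m: "(\<sigma> ^^ m) ?y = s e1" using LeastI_ex[OF ex] by (simp add: m_def)
  have least: "(\<sigma> ^^ j) ?y \<noteq> s e1" if "j < m" for j
    using that not_less_Least unfolding m_def by blast
  define A where "A = (\<lambda>k. (\<sigma> ^^ k) ?y) ` {..m}"
  have "s e1 \<in> A" using m by (force simp: A_def)
  moreover have "t e1 \<notin> A"
  proof
    assume "t e1 \<in> A"
    then obtain k where k: "k \<le> m" "t e1 = (\<sigma> ^^ k) ?y" by (auto simp: A_def)
    from pred[OF e01(2) _ k(2)] e01(3) have "k \<noteq> 0" "s e1 = (\<sigma> ^^ (k - 1)) ?y" by auto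
    moreover from this k(1) have "k - 1 < m" by linarith
    ultimately show False using least by metis
  qed
  moreover have "s e \<in> A \<longleftrightarrow> t e \<in> A" if e: "e \<in> E - {e0, e1}" for e
  proof
    assume "s e \<in> A"
    then obtain k where k: "k \<le> m" "s e = (\<sigma> ^^ k) ?y" by (auto simp: A_def)
    have "k \<noteq> m" using k m e e01 inj by (auto dest: inj_onD)
    moreover have "t e = (\<sigma> ^^ Suc k) ?y" using E[of e] e k by simp
    ultimately show "t e \<in> A" using k unfolding A_def by (intro image_eqI[of _ _ "Suc k"]) auto
  next
    assume "t e \<in> A"
    then obtain k where k: "k \<le> m" "t e = (\<sigma> ^^ k) ?y" by (auto simp: A_def)
    from pred[OF _ _ k(2)] e have "s e = (\<sigma> ^^ (k - 1)) ?y" by auto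
    then show "s e \<in> A" using k unfolding A_def by (intro image_eqI[of _ _ "k - 1"]) auto
  qed
  ultimately show ?thesis by blast
qed

section \<open>Edges of one color as a permutation of the pairs\<close>

context
  fixes D :: nat and B :: "('a, 'e) bubble" and \<Omega> :: "('a \<times> 'a) set"
  assumes bubble: "is_bubble D B" and pairing: "is_pairing B \<Omega>"
begin

lemma finite_pairing: "finite \<Omega>"
  using bubble pairing finite_subset[of \<Omega> "whites B \<times> blacks B"]
  by (auto simp: is_bubble_def is_pairing_def)

lemma pair_src:
  assumes "e \<in> bedges B"
  shows "src (pair_digraph B \<Omega>) e \<in> \<Omega> \<and> fst (src (pair_digraph B \<Omega>) e) = wend B e"
proof -
  have "wend B e \<in> whites B" using assms bubble by (auto simp: is_bubble_def)
  then have "\<exists>!b. (wend B e, b) \<in> \<Omega>" using pairing by (auto simp: is_pairing_def)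
  then have "\<exists>!x. x \<in> \<Omega> \<and> fst x = wend B e" by (metis fst_conv prod.collapse)
  from theI'[OF this] show ?thesis by (simp add: pair_digraph_def)
qed

lemma pair_tgt:
  assumes "e \<in> bedges B"
  shows "tgt (pair_digraph B \<Omega>) e \<in> \<Omega> \<and> snd (tgt (pair_digraph B \<Omega>) e) = bend B e"
proof -
  have "bend B e \<in> blacks B" using assms bubble by (auto simp: is_bubble_def)
  then have "\<exists>!w. (w, bend B e) \<in> \<Omega>" using pairing by (auto simp: is_pairing_def)
  then have "\<exists>!x. x \<in> \<Omega> \<and> snd x = bend B e" by (metis snd_conv prod.collapse)
  from theI'[OF this] show ?thesis by (simp add: pair_digraph_def)
qed

lemma pair_eqI: "x \<in> \<Omega> \<Longrightarrow> y \<in> \<Omega> \<Longrightarrow> fst x = fst y \<Longrightarrow> x = y"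
  using pairing unfolding is_pairing_def by (metis mem_Sigma_iff prod.collapse subsetD)

lemma edge_at_white:
  assumes "x \<in> \<Omega>" "i \<in> {1..D}"
  shows "\<exists>!e. e \<in> bedges B \<and> bcol B e = i \<and> wend B e = fst x"
proof -
  have "fst x \<in> whites B" using assms pairing by (auto simp: is_pairing_def)
  then show ?thesis using bubble assms(2) by (simp add: is_bubble_def)
qed

text \<open>From a pair, follow the edge of color \<open>i\<close> at its white vertex to the pair
  of the black end. Each black vertex has only one such edge, hence injectivity. Edges within a
  pair, absent from the digraph, become fixed points, so the map is defined on all of
  \<Omega>.\<close>

lemma color_permutation:
  assumes i: "i \<in> {1..D}"
  shows "\<exists>\<sigma>. \<sigma> ` \<Omega> \<subseteq> \<Omega> \<and> inj_on \<sigma> \<Omega> \<and> (\<forall>e\<in>bedges B. bcol B e = i \<longrightarrow>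
    \<sigma> (src (pair_digraph B \<Omega>) e) = tgt (pair_digraph B \<Omega>) e)"
proof -
  let ?s = "src (pair_digraph B \<Omega>)" and ?t = "tgt (pair_digraph B \<Omega>)"
  define \<epsilon> where "\<epsilon> x = (THE e. e \<in> bedges B \<and> bcol B e = i \<and> wend B e = fst x)" for x :: "'a \<times> 'a"
  have \<epsilon>: "\<epsilon> x \<in> bedges B \<and> bcol B (\<epsilon> x) = i \<and> wend B (\<epsilon> x) = fst x" if "x \<in> \<Omega>" for x
    unfolding \<epsilon>_def by (rule theI'[OF edge_at_white[OF that i]])
  have "inj_on (\<lambda>x. ?t (\<epsilon> x)) \<Omega>"
  proof (rule inj_onI)
    fix x y assume xy: "x \<in> \<Omega>" "y \<in> \<Omega>" "?t (\<epsilon> x) = ?t (\<epsilon> y)"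
    then have "bend B (\<epsilon> x) = bend B (\<epsilon> y)" using pair_tgt \<epsilon> by metis
    moreover have "bend B (\<epsilon> x) \<in> blacks B" using \<epsilon>[OF xy(1)] bubble by (auto simp: is_bubble_def)
    then have "\<exists>!e. e \<in> bedges B \<and> bcol B e = i \<and> bend B e = bend B (\<epsilon> x)"
      using bubble i by (simp add: is_bubble_def)
    ultimately have "\<epsilon> x = \<epsilon> y" using \<epsilon>[OF xy(1)] \<epsilon>[OF xy(2)] by metis
    then show "x = y" using \<epsilon>[OF xy(1)] \<epsilon>[OF xy(2)] pair_eqI xy by metis
  qed
  moreover have "\<epsilon> (?s e) = e" if "e \<in> bedges B" "bcol B e = i" for e
    using pair_src[OF that(1)] edge_at_white[OF _ i, of "?s e"] \<epsilon>[of "?s e"] that by metis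
  moreover have "(\<lambda>x. ?t (\<epsilon> x)) ` \<Omega> \<subseteq> \<Omega>" using pair_tgt \<epsilon> by blast
  ultimately show ?thesis by (intro exI[of _ "\<lambda>x. ?t (\<epsilon> x)"]) auto
qed

lemma inj_on_src:
  assumes i: "i \<in> {1..D}"
  shows "inj_on (src (pair_digraph B \<Omega>)) {e \<in> bedges B. bcol B e = i}"
proof (rule inj_onI, clarify)
  fix e e' assume e: "e \<in> bedges B" "e' \<in> bedges B" "bcol B e' = bcol B e" "i = bcol B e"
    "src (pair_digraph B \<Omega>) e = src (pair_digraph B \<Omega>) e'"
  then have "wend B e = wend B e'" using pair_src by metis
  with edge_at_white[of "src (pair_digraph B \<Omega>) e" i] i e pair_src show "e = e'" by metis
qed

text \<open>A kept edge lies on a cycle that lost another edge, and the stretch of the cycle between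
  the two is a cut. For a star edge the old endpoint alone is a cut, since the cycle edges there are
  gone. The cut is built for one dart of each edge; \<open>is_bridge_flip\<close> gives the
  other.\<close>

lemma reduced_map_bridge:
  assumes M: "is_bubble_map B \<Omega> M" and t: "is_treatment D M t" and R: "is_reduction_by D M t R"
    and i: "i \<in> {1..D}" and h: "h \<in> darts R" "i \<in> label R h"
  shows "is_bridge (att R) (flip R) {h \<in> darts R. i \<in> label R h} h"
proof -
  let ?G = "pair_digraph B \<Omega>" and ?Mi = "mono_submap i M"
  let ?S = "{h \<in> darts R. i \<in> label R h}"
  define E where "E = {e \<in> arcs ?G. acol ?G e = i}"
  have E_bedges: "E \<subseteq> {e \<in> bedges B. bcol B e = i}"
    by (auto simp: E_def pair_digraph_def)
  have cil: "is_ciliated_map ?G M" using M by (simp add: is_bubble_map_def)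
  have nodes: "nodes ?G = \<Omega>" by (simp add: pair_digraph_def)
  have vM: "verts M = \<Omega>"
    and dM: "darts M = Cilium ` \<Omega> \<union> Out ` arcs ?G \<union> In ` arcs ?G"
    and MC: "\<And>x. x \<in> \<Omega> \<Longrightarrow> label M (Cilium x) = {}"
    and MO: "\<And>e. e \<in> arcs ?G \<Longrightarrow> att M (Out e) = src ?G e \<and> flip M (Out e) = In e \<and> label M (Out e) = {acol ?G e}"
    and MI: "\<And>e. e \<in> arcs ?G \<Longrightarrow> att M (In e) = tgt ?G e \<and> flip M (In e) = Out e \<and> label M (In e) = {acol ?G e}"
    using cil unfolding is_ciliated_map_def nodes by blast+
  have Mi: "verts ?Mi = \<Omega>" "att ?Mi = att M" "flip ?Mi = flip M"
    by (simp_all add: mono_submap_def Let_def vM)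
  have dMi: "darts ?Mi = Out ` E \<union> In ` E"
    using MC MO MI unfolding mono_submap_def Let_def E_def dM by auto
  have st: "src ?G e \<in> \<Omega>" "tgt ?G e \<in> \<Omega>" if "e \<in> E" for e
    using that E_bedges pair_src pair_tgt by blast+
  have adjE: "(src ?G e, tgt ?G e) \<in> adj ?Mi" if "e \<in> E" for e
  proof -
    have "(att ?Mi (Out e), att ?Mi (flip ?Mi (Out e))) \<in> adj ?Mi"
      unfolding adj_def using that dMi by blast
    then show ?thesis using that MO MI by (simp add: Mi E_def)
  qed
  have adjMi: "adj ?Mi \<subseteq> {(src ?G e, tgt ?G e) | e. e \<in> E} \<union> {(tgt ?G e, src ?G e) | e. e \<in> E}"
    unfolding adj_def dMi Mi using MO MI by (auto simp: E_def)
  have closed: "src ?G e \<in> C \<longleftrightarrow> tgt ?G e \<in> C" if "e \<in> E" "C \<in> components ?Mi" for e C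
    using component_closed[OF that(2) adjE[OF that(1)]] st[OF that(1)] by (simp add: Mi)
  define K where "K = kept_darts D M t"
  \<comment> \<open>A surviving dart of color \<open>i\<close> shows that its component is an opened
    cycle, since a starred cycle keeps none of its edges.\<close>
  have keptD: "\<exists>e. t (i, C) = Some e \<and> k \<notin> e"
    if "k \<in> K" "i \<in> label M k" "C \<in> components ?Mi" "att M k \<in> C" for k C
  proof -
    have "k \<in> darts M" using that(1) by (auto simp: K_def kept_darts_def)
    then have "k \<in> darts ?Mi" using that(2) by (simp add: mono_submap_def Let_def)
    then have "(i, C) \<in> mono_cycles D M" using i that(3,4) by (auto simp: mono_cycles_def)
    then show ?thesis using that by (auto simp: K_def kept_darts_def)
  qed
  have K_sub: "K \<subseteq> darts M" by (auto simp: K_def kept_darts_def)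
  have starD: "C \<in> components ?Mi \<and> t (i, C) = None" if "(i, C) \<in> starred D M t" for C
    using that by (auto simp: starred_def mono_cycles_def)
  have wfR: "wf_map R"
    and dR: "darts R = Kept ` K \<union> {Spoke i C x | i C x. (i, C) \<in> starred D M t \<and> x \<in> C}
        \<union> {Ray i C x | i C x. (i, C) \<in> starred D M t \<and> x \<in> C}"
    and RK: "\<And>h. h \<in> K \<Longrightarrow> att R (Kept h) = Old (att M h) \<and> flip R (Kept h) = Kept (flip M h)
          \<and> label R (Kept h) = label M h"
    and RS: "\<And>i C x. (i, C) \<in> starred D M t \<Longrightarrow> x \<in> C \<Longrightarrow>
          att R (Spoke i C x) = Old x \<and> flip R (Spoke i C x) = Ray i C x \<and> label R (Spoke i C x) = {i}
          \<and> att R (Ray i C x) = Hub i C \<and> flip R (Ray i C x) = Spoke i C x \<and> label R (Ray i C x) = {i}"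
  proof -
    note R' = R[unfolded is_reduction_by_def Let_def, folded K_def]
    from R' show "wf_map R" by (elim conjE) assumption
    from R' show "darts R = Kept ` K \<union> {Spoke i C x | i C x. (i, C) \<in> starred D M t \<and> x \<in> C}
        \<union> {Ray i C x | i C x. (i, C) \<in> starred D M t \<and> x \<in> C}" by (elim conjE) assumption
    from R' have K': "\<forall>h\<in>K. att R (Kept h) = Old (att M h) \<and> flip R (Kept h) = Kept (flip M h)
          \<and> label R (Kept h) = label M h
          \<and> first_return (rot R) (Kept ` K) (Kept h) = Kept (first_return (rot M) K h)"
      by (elim conjE) assumption
    then show "att R (Kept h) = Old (att M h) \<and> flip R (Kept h) = Kept (flip M h)
          \<and> label R (Kept h) = label M h" if "h \<in> K" for h
      using that by blast
    from R' have S': "\<forall>(i, C)\<in>starred D M t. \<forall>x\<in>C.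
          att R (Spoke i C x) = Old x \<and> flip R (Spoke i C x) = Ray i C x \<and> label R (Spoke i C x) = {i}
          \<and> att R (Ray i C x) = Hub i C \<and> flip R (Ray i C x) = Spoke i C x \<and> label R (Ray i C x) = {i}"
      by (elim conjE) assumption
    then show "att R (Spoke i C x) = Old x \<and> flip R (Spoke i C x) = Ray i C x \<and> label R (Spoke i C x) = {i}
          \<and> att R (Ray i C x) = Hub i C \<and> flip R (Ray i C x) = Spoke i C x \<and> label R (Ray i C x) = {i}"
      if "(i, C) \<in> starred D M t" "x \<in> C" for i C x
      using that by blast
  qed
  have flipR: "flip R k \<in> darts R" "flip R (flip R k) = k" "label R (flip R k) = label R k" if "k \<in> darts R" for k
    using that wfR by (auto simp: wf_map_def wf_graph_def)
  have cases_S: "(\<exists>e\<in>E. k = Kept (Out e) \<and> Out e \<in> K) \<or> (\<exists>e\<in>E. k = Kept (In e) \<and> In e \<in> K)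
      \<or> (\<exists>C x. (i, C) \<in> starred D M t \<and> x \<in> C \<and> k \<in> {Spoke i C x, Ray i C x})"
    if "k \<in> ?S" for k
  proof -
    from that consider k' where "k = Kept k'" "k' \<in> K"
      | j C x where "(j, C) \<in> starred D M t" "x \<in> C" "k = Spoke j C x \<or> k = Ray j C x"
      unfolding dR by blast
    then show ?thesis
    proof cases
      case 1
      then have "i \<in> label M k'" using that RK by auto
      then have "k' \<in> Out ` E \<union> In ` E"
        using 1 K_sub unfolding dMi[symmetric] by (auto simp: mono_submap_def Let_def)
      then show ?thesis using 1 by blast
    next
      case 2
      then have "j = i" using that RS[OF 2(1,2)] by auto
      then show ?thesis using 2 by blast
    qed
  qed
  have attE: "att M (Out e) = src ?G e" "att M (In e) = tgt ?G e" "flip M (Out e) = In e" "flip M (In e) = Out e"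
    "i \<in> label M (Out e)" "i \<in> label M (In e)" if "e \<in> E" for e
    using that MO MI by (auto simp: E_def)
  have main_out: "is_bridge (att R) (flip R) ?S (Kept (Out e1))" if e1: "e1 \<in> E" "Out e1 \<in> K" for e1
  proof -
    define C where "C = component_of ?Mi (src ?G e1)"
    have C: "C \<in> components ?Mi" "src ?G e1 \<in> C"
      unfolding C_def using st(1)[OF e1(1)] component_of_in component_of_self by (metis Mi(1))+
    with keptD[OF e1(2) attE(5)[OF e1(1)] C(1)] attE(1)[OF e1(1)]
    obtain X where X: "t (i, C) = Some X" "Out e1 \<notin> X" by auto
    have "Out e1 \<in> darts ?Mi" using dMi e1 by auto
    then have "(i, C) \<in> mono_cycles D M"
      using C i attE(1)[OF e1(1)] by (force simp: mono_cycles_def)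
    then have "X \<in> edges ?Mi" "att M ` X \<subseteq> C"
      using t X(1) unfolding is_treatment_def by blast+
    then obtain e0 where e0: "e0 \<in> E" "X = {Out e0, In e0}"
      unfolding edges_def dMi Mi using attE by (auto simp: insert_commute)
    have "tgt ?G e0 \<in> C" using \<open>att M ` X \<subseteq> C\<close> e0 attE by auto
    obtain \<sigma> where \<sigma>: "\<sigma> ` \<Omega> \<subseteq> \<Omega>" "inj_on \<sigma> \<Omega>" "\<And>e. e \<in> E \<Longrightarrow> \<sigma> (src ?G e) = tgt ?G e"
      using color_permutation[OF i] E_bedges by blast
    \<comment> \<open>A walk along edges of color \<open>i\<close>, in either direction, stays in
      one orbit of \<sigma>; this puts the source of \<open>e1\<close> on the orbit of the target of
      \<open>e0\<close>.\<close>
    have "reach \<Omega> (adj ?Mi) \<subseteq> reach \<Omega> {(x, \<sigma> x) | x. x \<in> \<Omega>}"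
    proof (rule reach_least[OF _ reach_equiv])
      show "adj ?Mi \<subseteq> \<Omega> \<times> \<Omega>" using adjMi st by blast
      have fwd: "(src ?G e, tgt ?G e) \<in> reach \<Omega> {(x, \<sigma> x) | x. x \<in> \<Omega>}" if "e \<in> E" for e
      proof (rule reach_edge)
        show "(src ?G e, tgt ?G e) \<in> {(x, \<sigma> x) | x. x \<in> \<Omega>}"
          using \<sigma>(3)[OF that, symmetric] st(1)[OF that] by blast
      qed (use st[OF that] in auto)
      have bwd: "(tgt ?G e, src ?G e) \<in> reach \<Omega> {(x, \<sigma> x) | x. x \<in> \<Omega>}" if "e \<in> E" for e
        by (rule reach_sym[OF fwd[OF that]])
      show "adj ?Mi \<subseteq> reach \<Omega> {(x, \<sigma> x) | x. x \<in> \<Omega>}"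
        by (intro subset_trans[OF adjMi] Un_least subsetI; elim CollectE exE conjE; simp only: fwd bwd)
    qed
    moreover have "(tgt ?G e0, src ?G e1) \<in> reach \<Omega> (adj ?Mi)"
      using component_of_eq[OF C(1) \<open>tgt ?G e0 \<in> C\<close>] C(2) by (auto simp: component_of_def Mi)
    ultimately have "src ?G e1 \<in> orbit \<sigma> (tgt ?G e0)"
      using orbit_eq_reach[OF finite_pairing \<sigma>(1,2) st(2)[OF e0(1)]] by auto
    moreover have "inj_on (src ?G) E" using inj_on_subset[OF inj_on_src[OF i] E_bedges] .
    moreover have "e0 \<noteq> e1" using e0 X by auto
    ultimately have "\<exists>A. src ?G e1 \<in> A \<and> tgt ?G e1 \<notin> A \<and>
        (\<forall>e\<in>E - {e0, e1}. src ?G e \<in> A \<longleftrightarrow> tgt ?G e \<in> A)"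
      using \<sigma>(3) st e0(1) e1(1)
      by (intro permutation_segment[OF finite_pairing \<sigma>(1,2)]) auto
    then obtain A where A: "src ?G e1 \<in> A" "tgt ?G e1 \<notin> A"
      "\<And>e. e \<in> E - {e0, e1} \<Longrightarrow> src ?G e \<in> A \<longleftrightarrow> tgt ?G e \<in> A"
      by (elim exE conjE) auto
    \<comment> \<open>Neither dart of the opened edge survives, so the exceptional edge
      \<open>e0\<close> of the segment does not occur in \<open>R\<close>.\<close>
    have notK: "e \<noteq> e0" if "Out e \<in> K \<or> In e \<in> K" "e \<in> E" for e
    proof
      assume "e = e0"
      then have "\<exists>k\<in>X. k \<in> K \<and> i \<in> label M k \<and> att M k \<in> C"
        using that e0 attE[OF that(2)] \<open>att M ` X \<subseteq> C\<close> by auto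
      then show False using keptD[OF _ _ C(1)] X by fastforce
    qed
    have K: "att R (Kept k) = Old (att M k)" "flip R (Kept k) = Kept (flip M k)" "flip M k \<in> K" if "k \<in> K" for k
      using RK[OF that] flipR(1)[of "Kept k"] that unfolding dR by auto
    show ?thesis
      unfolding is_bridge_def
    \<comment> \<open>Intersecting with the opened cycle \<open>C\<close> leaves both ends of every
      star edge outside: stars belong to other components, and their new vertices are not of the
      form \<open>Old\<close>.\<close>
    proof (intro exI[of _ "Old ` (A \<inter> C)"] conjI ballI)
      show "att R (Kept (Out e1)) \<in> Old ` (A \<inter> C)"
        using K[OF e1(2)] attE[OF e1(1)] A C by simp
      have "In e1 \<in> K" using K(3)[OF e1(2)] attE[OF e1(1)] by simp
      then show "att R (flip R (Kept (Out e1))) \<notin> Old ` (A \<inter> C)"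
        using K[OF e1(2)] K[of "In e1"] attE[OF e1(1)] A by auto
      fix k assume k: "k \<in> ?S - {Kept (Out e1), flip R (Kept (Out e1))}"
      then have k': "k \<noteq> Kept (Out e1)" "k \<noteq> Kept (In e1)" using K[OF e1(2)] attE[OF e1(1)] by auto
      have "k \<in> ?S" using k by blast
      from cases_S[OF this] show "att R k \<in> Old ` (A \<inter> C) \<longleftrightarrow> att R (flip R k) \<in> Old ` (A \<inter> C)"
      proof (elim disjE bexE exE conjE)
        fix e assume e: "e \<in> E" "k = Kept (Out e)" "Out e \<in> K"
        then have "e \<in> E - {e0, e1}" using notK k' by auto
        then show ?thesis
          using A(3)[of e] closed[OF e(1) C(1)] K[OF e(3)] K(1)[of "In e"] attE[OF e(1)] e(2) by auto
      next
        fix e assume e: "e \<in> E" "k = Kept (In e)" "In e \<in> K"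
        then have "e \<in> E - {e0, e1}" using notK k' by auto
        then show ?thesis
          using A(3)[of e] closed[OF e(1) C(1)] K[OF e(3)] K(1)[of "Out e"] attE[OF e(1)] e(2) by auto
      next
        fix C' x assume *: "(i, C') \<in> starred D M t" "x \<in> C'" and kk: "k \<in> {Spoke i C' x, Ray i C' x}"
        have "x \<notin> C"
        proof
          assume "x \<in> C"
          then have "C = C'" using component_of_eq C(1) starD[OF *(1)] *(2) by metis
          then show False using starD[OF *(1)] X by simp
        qed
        then show ?thesis using RS[OF *] kk by auto
      qed
    qed
  qed
  have main_spoke: "is_bridge (att R) (flip R) ?S (Spoke i C x)" if C: "(i, C) \<in> starred D M t" "x \<in> C" for C x
    unfolding is_bridge_def
  \<comment> \<open>The vertex \<open>x\<close> lies in just one component of color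
    \<open>i\<close>. As that one is starred, the spoke is the only edge of color \<open>i\<close>
    at \<open>x\<close>.\<close>
  proof (intro exI[of _ "{Old x}"] conjI ballI)
    show "att R (Spoke i C x) \<in> {Old x}" "att R (flip R (Spoke i C x)) \<notin> {Old x}"
      using RS[OF C] by auto
    have kept_far: "att M k \<noteq> x" if "k \<in> K" "i \<in> label M k" for k
    proof
      assume "att M k = x"
      then show False using keptD[OF that, of C] starD[OF C(1)] C(2) by auto
    qed
    fix k assume k: "k \<in> ?S - {Spoke i C x, flip R (Spoke i C x)}"
    then have "k \<in> ?S" by blast
    have K: "att R (Kept k) = Old (att M k)" "flip R (Kept k) = Kept (flip M k)" "flip M k \<in> K" if "k \<in> K" for k
      using RK[OF that] flipR(1)[of "Kept k"] that unfolding dR by auto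
    from cases_S[OF \<open>k \<in> ?S\<close>] show "att R k \<in> {Old x} \<longleftrightarrow> att R (flip R k) \<in> {Old x}"
    proof (elim disjE bexE exE conjE)
      fix e assume e: "e \<in> E" "k = Kept (Out e)" "Out e \<in> K"
      then show ?thesis
        using kept_far[of "Out e"] kept_far[of "In e"] K[OF e(3)] K(1)[of "In e"] attE[OF e(1)] by auto
    next
      fix e assume e: "e \<in> E" "k = Kept (In e)" "In e \<in> K"
      then show ?thesis
        using kept_far[of "Out e"] kept_far[of "In e"] K[OF e(3)] K(1)[of "Out e"] attE[OF e(1)] by auto
    next
      fix C' y assume *: "(i, C') \<in> starred D M t" "y \<in> C'" and kk: "k \<in> {Spoke i C' y, Ray i C' y}"
      have "y \<noteq> x"
      proof
        assume "y = x"
        then have "C = C'"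
          using component_of_eq[of C ?Mi x] component_of_eq[of C' ?Mi x] starD[OF C(1)] starD[OF *(1)] C(2) *(2)
          by simp
        then show False using k kk \<open>y = x\<close> RS[OF C] by auto
      qed
      then show ?thesis using RS[OF *] kk by auto
    qed
  qed
  have "h \<in> ?S" using h by simp
  from cases_S[OF this] show ?thesis
  proof (elim disjE bexE exE conjE)
    fix e assume "e \<in> E" "h = Kept (Out e)" "Out e \<in> K"
    then show ?thesis using main_out by simp
  next
    fix e assume e: "e \<in> E" "h = Kept (In e)" "In e \<in> K"
    then have f: "flip R h = Kept (Out e)" using RK attE by simp
    then have "Out e \<in> K" using flipR(1)[OF h(1)] unfolding dR by auto
    from main_out[OF e(1) this] show ?thesis
      using is_bridge_flip[of "att R" "flip R" ?S "Kept (Out e)"] flipR(2)[OF h(1)] f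
        flipR(2)[OF flipR(1)[OF h(1)]] by simp
  next
    fix C x assume *: "(i, C) \<in> starred D M t" "x \<in> C" and "h \<in> {Spoke i C x, Ray i C x}"
    then show ?thesis
      using main_spoke[OF *] is_bridge_flip[OF main_spoke[OF *]] RS[OF *] by auto
  qed
qed

end

section \<open>Stuffed maps\<close>

lemma card_darts_eq_edges:
  assumes wf: "wf_graph G" and nofix: "\<And>h. h \<in> darts G \<Longrightarrow> flip G h \<noteq> h"
  shows "card (darts G) = 2 * card (edges G)"
proof -
  have fl: "flip G h \<in> darts G" "flip G (flip G h) = h" if "h \<in> darts G" for h
    using that wf by (auto simp: wf_graph_def)
  have "\<Union> (edges G) = darts G"
  proof
    show "\<Union> (edges G) \<subseteq> darts G" using fl by (auto simp: edges_def)
    have "h \<in> {h, flip G h}" "{h, flip G h} \<in> edges G" if "h \<in> darts G" for h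
      using that nofix by (auto simp: edges_def)
    then show "darts G \<subseteq> \<Union> (edges G)" by blast
  qed
  moreover have "pairwise disjnt (edges G)"
  proof (rule pairwiseI)
    fix e e' assume "e \<in> edges G" "e' \<in> edges G" "e \<noteq> e'"
    then obtain h h' where h: "h \<in> darts G" "h' \<in> darts G" "e = {h, flip G h}" "e' = {h', flip G h'}"
      "{h, flip G h} \<noteq> {h', flip G h'}"
      by (auto simp: edges_def)
    then have "h \<noteq> h'" "h \<noteq> flip G h'" "flip G h \<noteq> h'" "flip G h \<noteq> flip G h'"
      using fl(2)[OF h(1)] fl(2)[OF h(2)] by (metis insert_commute)+
    then show "disjnt e e'" using h by (auto simp: disjnt_def)
  qed
  moreover have "finite e" "card e = 2" if "e \<in> edges G" for e
    using that by (auto simp: edges_def)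
  ultimately show ?thesis
    using card_Union_disjoint[of "edges G"] by simp
qed

section \<open>A stuffed map and the copies in its blue part\<close>

context
  fixes W :: "('v, 'h) stuffed_map" and R :: "('w, 'k) colored_map"
  assumes W: "W \<in> W0 R"
begin

lemma W0_wf: "wf_map W"
  and W0_nofix: "h \<in> darts W \<Longrightarrow> flip W h \<noteq> h"
  and W0_connected: "connected_graph W"
  and W0_black: "black_verts W \<subseteq> verts W"
  and W0_black_blue: "h \<in> darts W \<Longrightarrow> att W h \<in> black_verts W \<Longrightarrow> att W (flip W h) \<notin> black_verts W"
  and W0_iso: "C \<in> components (blue_part W) \<Longrightarrow> map_iso (restrict_verts (blue_part W) C) R"
  and W0_label: "h \<in> darts W \<Longrightarrow> att W (flip W h) \<in> black_verts W \<Longrightarrow>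
          label W h = \<Union> (label (blue_part W) ` {h' \<in> darts (blue_part W). att W h' = att W h})"
  using W unfolding W0_def by blast+

lemma W0_finite: "finite (verts W)" "finite (darts W)"
  and W0_att: "h \<in> darts W \<Longrightarrow> att W h \<in> verts W"
  and W0_flip: "h \<in> darts W \<Longrightarrow> flip W h \<in> darts W" "h \<in> darts W \<Longrightarrow> flip W (flip W h) = h"
  and W0_label_flip: "h \<in> darts W \<Longrightarrow> label W (flip W h) = label W h"
  using W0_wf by (auto simp: wf_map_def wf_graph_def)

lemma blue_simps:
  "verts (blue_part W) = verts W - black_verts W"
  "h \<in> darts (blue_part W) \<longleftrightarrow> h \<in> darts W \<and> att W h \<notin> black_verts W"
  "att (blue_part W) = att W"
  "flip (blue_part W) h = (if att W (flip W h) \<in> black_verts W then h else flip W h)"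
  "label (blue_part W) h = (if att W (flip W h) \<in> black_verts W then {} else label W h)"
  by (simp_all add: blue_part_def)

lemma blue_flip:
  assumes "h \<in> darts (blue_part W)"
  shows "flip (blue_part W) h \<in> darts (blue_part W)"
  using assms W0_flip by (auto simp: blue_simps)

text \<open>Cilia of the blue part are exactly the traces of black-blue edges, because the flip of
  \<open>W\<close> itself fixes no dart.\<close>

lemma blue_fixed: "h \<in> darts (blue_part W) \<Longrightarrow>
    flip (blue_part W) h = h \<longleftrightarrow> att W (flip W h) \<in> black_verts W"
  using W0_nofix by (auto simp: blue_simps)

lemma finite_blue: "finite (verts (blue_part W))" "finite (darts (blue_part W))"
  using W0_finite by (auto simp: blue_part_def)

lemma blue_component_flip:
  assumes "h \<in> darts (blue_part W)"
  shows "component_of (blue_part W) (att W (flip (blue_part W) h)) = component_of (blue_part W) (att W h)"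
proof (rule component_of_adj[symmetric])
  show "(att W h, att W (flip (blue_part W) h)) \<in> adj (blue_part W)"
    using assms by (auto simp: adj_def blue_simps(3))
  show "att W h \<in> verts (blue_part W)" "att W (flip (blue_part W) h) \<in> verts (blue_part W)"
    using assms blue_flip[OF assms] W0_att by (auto simp: blue_simps(1,2))
qed

lemma blue_component_flip_iff:
  assumes "h \<in> darts (blue_part W)" "C \<in> components (blue_part W)"
  shows "att W (flip (blue_part W) h) \<in> C \<longleftrightarrow> att W h \<in> C"
proof -
  have "att W h \<in> verts (blue_part W)" "att W (flip (blue_part W) h) \<in> verts (blue_part W)"
    using assms(1) blue_flip[OF assms(1)] W0_att by (auto simp: blue_simps(1,2))
  then show ?thesis
    using blue_component_flip[OF assms(1)] component_of_eq[OF assms(2)] component_of_self by metis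
qed

lemma blue_component:
  assumes "h \<in> darts (blue_part W)"
  shows "component_of (blue_part W) (att W h) \<in> components (blue_part W)"
    "att W h \<in> component_of (blue_part W) (att W h)"
proof -
  have "att W h \<in> verts (blue_part W)" using assms W0_att by (auto simp: blue_simps(1,2))
  then show "component_of (blue_part W) (att W h) \<in> components (blue_part W)"
    "att W h \<in> component_of (blue_part W) (att W h)"
    by (simp_all add: component_of_in component_of_self)
qed

text \<open>Rotations are dropped here: counts and cuts only see incidences and labels.\<close>

lemma blue_iso:
  assumes "C \<in> components (blue_part W)"
  shows "\<exists>f g. bij_betw f C (verts R) \<and>
    bij_betw g {h \<in> darts (blue_part W). att W h \<in> C} (darts R) \<and>
    (\<forall>h. h \<in> darts (blue_part W) \<longrightarrow> att W h \<in> C \<longrightarrow> att R (g h) = f (att W h)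
       \<and> flip R (g h) = g (flip (blue_part W) h) \<and> label R (g h) = label (blue_part W) h)"
  using W0_iso[OF assms] unfolding map_iso_def by (simp add: blue_simps(3) restrict_verts_def) blast

section \<open>Counting copy by copy\<close>

lemma disjoint_components:
  "C \<in> components (blue_part W) \<Longrightarrow> C' \<in> components (blue_part W) \<Longrightarrow> C \<noteq> C' \<Longrightarrow> C \<inter> C' = {}"
  by (metis component_of_eq disjoint_iff)

lemma finite_components: "finite (components (blue_part W))"
  using finite_blue by (simp add: components_def)

text \<open>Transfers a count from \<open>R\<close> to all its copies. The isomorphisms exist
  componentwise and are not canonical, so the match between \<open>P\<close> and \<open>Q\<close> is
  assumed for every choice of them.\<close>

lemma card_blue_darts:
  assumes "\<And>C f g h. C \<in> components (blue_part W) \<Longrightarrow> bij_betw f C (verts R) \<Longrightarrow>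
     bij_betw g {h \<in> darts (blue_part W). att W h \<in> C} (darts R) \<Longrightarrow>
     (\<And>h. h \<in> darts (blue_part W) \<Longrightarrow> att W h \<in> C \<Longrightarrow> att R (g h) = f (att W h)
       \<and> flip R (g h) = g (flip (blue_part W) h) \<and> label R (g h) = label (blue_part W) h) \<Longrightarrow>
     h \<in> darts (blue_part W) \<Longrightarrow> att W h \<in> C \<Longrightarrow> P h \<longleftrightarrow> Q (g h)"
  shows "card {h \<in> darts (blue_part W). P h} = card (components (blue_part W)) * card {k \<in> darts R. Q k}"
proof -
  let ?X = "\<lambda>C. {h \<in> darts (blue_part W). att W h \<in> C \<and> P h}"
  have "card (?X C) = card {k \<in> darts R. Q k}" if C: "C \<in> components (blue_part W)" for C
  proof -
    obtain f g where fg: "bij_betw f C (verts R)"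
      "bij_betw g {h \<in> darts (blue_part W). att W h \<in> C} (darts R)"
      "\<And>h. h \<in> darts (blue_part W) \<Longrightarrow> att W h \<in> C \<Longrightarrow> att R (g h) = f (att W h)
       \<and> flip R (g h) = g (flip (blue_part W) h) \<and> label R (g h) = label (blue_part W) h"
      using blue_iso[OF C] by blast
    have P: "P h \<longleftrightarrow> Q (g h)" if "h \<in> darts (blue_part W)" "att W h \<in> C" for h
      using assms[OF C fg that] .
    have "bij_betw g (?X C) {k \<in> darts R. Q k}"
      unfolding bij_betw_def
    proof
      show "inj_on g (?X C)"
        using fg(2) by (auto simp: bij_betw_def intro: inj_on_subset)
      show "g ` ?X C = {k \<in> darts R. Q k}"
      proof
        show "g ` ?X C \<subseteq> {k \<in> darts R. Q k}"
          using bij_betwE[OF fg(2)] P by auto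
        show "{k \<in> darts R. Q k} \<subseteq> g ` ?X C"
          unfolding bij_betw_imp_surj_on[OF fg(2), symmetric] using P by auto
      qed
    qed
    then show ?thesis by (rule bij_betw_same_card)
  qed
  moreover have "{h \<in> darts (blue_part W). P h} = (\<Union>C\<in>components (blue_part W). ?X C)"
    using blue_component by blast
  moreover have "card (\<Union>C\<in>components (blue_part W). ?X C) = (\<Sum>C\<in>components (blue_part W). card (?X C))"
  proof (intro card_UN_disjoint finite_components ballI impI)
    show "finite (?X C)" for C using finite_blue by simp
    show "?X C \<inter> ?X C' = {}"
      if "C \<in> components (blue_part W)" "C' \<in> components (blue_part W)" "C \<noteq> C'" for C C'
      using disjoint_components[OF that] by blast
  qed
  ultimately show ?thesis by simp
qed

lemma card_verts_W0:
  "card (verts W) = card (black_verts W) + card (components (blue_part W)) * card (verts R)"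
proof -
  have U: "\<Union> (components (blue_part W)) = verts (blue_part W)"
    by (auto simp: components_def component_of_def reach_def)
  have "card (\<Union> (components (blue_part W))) = sum card (components (blue_part W))"
  proof (rule card_Union_disjoint)
    show "pairwise disjnt (components (blue_part W))"
      using disjoint_components by (auto simp: pairwise_def disjnt_def)
    show "finite C" if "C \<in> components (blue_part W)" for C
      by (rule finite_subset[OF _ finite_blue(1)]) (use that U in auto)
  qed
  moreover have "card C = card (verts R)" if C: "C \<in> components (blue_part W)" for C
    using blue_iso[OF C] by (elim exE conjE) (rule bij_betw_same_card)
  ultimately have "card (verts (blue_part W)) = card (components (blue_part W)) * card (verts R)"
    using U by simp
  moreover have "card (verts W) = card (black_verts W) + card (verts (blue_part W))"
    using W0_black W0_finite card_mono[OF W0_finite(1) W0_black] finite_subset[OF W0_black]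
    by (simp add: blue_simps card_Diff_subset)
  ultimately show ?thesis by simp
qed

lemma card_cilia: "card {h \<in> darts (blue_part W). flip (blue_part W) h = h} =
    card (components (blue_part W)) * card {k \<in> darts R. flip R k = k}"
proof (rule card_blue_darts)
  fix C f g h
  assume C: "C \<in> components (blue_part W)" "bij_betw g {h \<in> darts (blue_part W). att W h \<in> C} (darts R)"
    "\<And>h. h \<in> darts (blue_part W) \<Longrightarrow> att W h \<in> C \<Longrightarrow> att R (g h) = f (att W h)
       \<and> flip R (g h) = g (flip (blue_part W) h) \<and> label R (g h) = label (blue_part W) h"
    "h \<in> darts (blue_part W)" "att W h \<in> C"
  \<comment> \<open>The flipped dart stays in the same copy, where \<open>g\<close> is injective;
    this makes fixed darts correspond to fixed darts.\<close>
  then have "flip (blue_part W) h \<in> {h \<in> darts (blue_part W). att W h \<in> C}"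
    using blue_flip blue_component_flip_iff by auto
  then show "flip (blue_part W) h = h \<longleftrightarrow> flip R (g h) = g h"
    using C by (auto simp: bij_betw_def dest: inj_onD)
qed

text \<open>A cilium of a copy has the empty label, while the black-blue edge in its place carries
  all colors at the blue endpoint. Hence the search in \<open>R\<close> for some dart
  \<open>l\<close> of color \<open>i\<close> at the same vertex.\<close>

lemma card_colored_cilia:
  "card {h \<in> darts (blue_part W). flip (blue_part W) h = h \<and> i \<in> label W h} =
    card (components (blue_part W)) *
    card {k \<in> darts R. flip R k = k \<and> (\<exists>l\<in>darts R. att R l = att R k \<and> i \<in> label R l)}"
proof (rule card_blue_darts)
  fix C f g h
  assume C: "C \<in> components (blue_part W)" "bij_betw f C (verts R)"
    "bij_betw g {h \<in> darts (blue_part W). att W h \<in> C} (darts R)"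
    and iso: "\<And>h. h \<in> darts (blue_part W) \<Longrightarrow> att W h \<in> C \<Longrightarrow> att R (g h) = f (att W h)
       \<and> flip R (g h) = g (flip (blue_part W) h) \<and> label R (g h) = label (blue_part W) h"
    and h: "h \<in> darts (blue_part W)" "att W h \<in> C"
  have "flip (blue_part W) h \<in> {h \<in> darts (blue_part W). att W h \<in> C}"
    using C h blue_flip blue_component_flip_iff by auto
  then have fixed: "flip (blue_part W) h = h \<longleftrightarrow> flip R (g h) = g h"
    using C iso h by (auto simp: bij_betw_def dest: inj_onD)
  have finj: "att W h' = att W h \<longleftrightarrow> f (att W h') = f (att W h)" if "att W h' \<in> C" for h'
    using C(2) h(2) that by (auto simp: bij_betw_def dest: inj_onD)
  have dR: "darts R = g ` {h \<in> darts (blue_part W). att W h \<in> C}"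
    using C(3) by (simp add: bij_betw_def)
  have "(\<exists>h'\<in>darts (blue_part W). att W h' = att W h \<and> i \<in> label (blue_part W) h') \<longleftrightarrow>
      (\<exists>l\<in>darts R. att R l = att R (g h) \<and> i \<in> label R l)" (is "?L \<longleftrightarrow> ?R")
  proof
    assume ?L
    then obtain h' where h': "h' \<in> darts (blue_part W)" "att W h' = att W h" "i \<in> label (blue_part W) h'" by auto
    then have "g h' \<in> darts R" "att R (g h') = att R (g h)" "i \<in> label R (g h')"
      using iso[of h'] iso[OF h] h dR by auto
    then show ?R by blast
  next
    assume ?R
    then obtain h' where h': "h' \<in> darts (blue_part W)" "att W h' \<in> C" "att R (g h') = att R (g h)"
      "i \<in> label R (g h')" unfolding dR by auto
    then show ?L using iso[of h'] iso[OF h] finj[of h'] by auto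
  qed
  moreover have "i \<in> label W h \<longleftrightarrow> (\<exists>h'\<in>darts (blue_part W). att W h' = att W h \<and> i \<in> label (blue_part W) h')"
    if "flip (blue_part W) h = h"
    using W0_label[of h] that h(1) blue_fixed[OF h(1)] by (auto simp: blue_simps(2))
  ultimately show "(flip (blue_part W) h = h \<and> i \<in> label W h) \<longleftrightarrow>
      (flip R (g h) = g h \<and> (\<exists>l\<in>darts R. att R l = att R (g h) \<and> i \<in> label R l))"
    using fixed by blast
qed

lemma card_flip_image: "Z \<subseteq> darts W \<Longrightarrow> card (flip W ` Z) = card Z"
  by (intro card_image inj_on_inverseI[of _ "flip W"]) (use W0_flip in auto)

text \<open>Darts inside copies count once, whereas a cilium stands for an edge with a blue and a
  black dart of equal label: hence the factor 2.\<close>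

lemma card_colored_darts:
  "card {h \<in> darts W. i \<in> label W h} = card (components (blue_part W)) *
    (card {k \<in> darts R. i \<in> label R k} +
     2 * card {k \<in> darts R. flip R k = k \<and> (\<exists>l\<in>darts R. att R l = att R k \<and> i \<in> label R l)})"
proof -
  let ?Y = "{h \<in> darts (blue_part W). i \<in> label (blue_part W) h}"
  let ?Z = "{h \<in> darts (blue_part W). flip (blue_part W) h = h \<and> i \<in> label W h}"
  have Z: "?Z = {h \<in> darts W. att W h \<notin> black_verts W \<and> att W (flip W h) \<in> black_verts W \<and> i \<in> label W h}"
    using blue_fixed by (auto simp: blue_simps(2))
  have Y: "?Y = {h \<in> darts W. att W h \<notin> black_verts W \<and> att W (flip W h) \<notin> black_verts W \<and> i \<in> label W h}"
    by (auto simp: blue_simps)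
  have fZ: "flip W ` ?Z = {h \<in> darts W. att W h \<in> black_verts W \<and> i \<in> label W h}"
    unfolding Z
  proof (intro equalityI subsetI)
    fix h assume h: "h \<in> {h \<in> darts W. att W h \<in> black_verts W \<and> i \<in> label W h}"
    show "h \<in> flip W ` {h \<in> darts W. att W h \<notin> black_verts W \<and> att W (flip W h) \<in> black_verts W \<and> i \<in> label W h}"
      by (rule image_eqI[of _ _ "flip W h"]) (use h W0_flip W0_label_flip W0_black_blue in auto)
  qed (use W0_flip W0_label_flip in auto)
  have "{h \<in> darts W. i \<in> label W h} = ?Y \<union> (?Z \<union> flip W ` ?Z)"
    unfolding Y fZ unfolding Z by auto
  moreover have "finite ?Y" "finite ?Z" using finite_blue by auto
  moreover have "?Y \<inter> (?Z \<union> flip W ` ?Z) = {}" "?Z \<inter> flip W ` ?Z = {}"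
    unfolding Y fZ unfolding Z by auto
  ultimately have "card {h \<in> darts W. i \<in> label W h} = card ?Y + (card ?Z + card (flip W ` ?Z))"
    by (simp add: card_Un_disjoint)
  moreover have "card (flip W ` ?Z) = card ?Z" by (rule card_flip_image) (auto simp: blue_simps)
  moreover have "card ?Y = card (components (blue_part W)) * card {k \<in> darts R. i \<in> label R k}"
    by (rule card_blue_darts) auto
  ultimately show ?thesis
    using card_colored_cilia[of i] by (simp add: algebra_simps)
qed

section \<open>The projected map\<close>

lemma card_darts_projected:
  "card (darts (projected W)) = 2 * (card (components (blue_part W)) * card {k \<in> darts R. flip R k = k})"
proof -
  let ?Z = "{h \<in> darts (blue_part W). flip (blue_part W) h = h}"
  have Z: "?Z = {h \<in> darts W. att W h \<notin> black_verts W \<and> att W (flip W h) \<in> black_verts W}"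
    using blue_fixed by (auto simp: blue_simps(2))
  have fZ: "flip W ` ?Z = {h \<in> darts W. att W h \<in> black_verts W}"
    unfolding Z
  proof (intro equalityI subsetI)
    fix h assume h: "h \<in> {h \<in> darts W. att W h \<in> black_verts W}"
    show "h \<in> flip W ` {h \<in> darts W. att W h \<notin> black_verts W \<and> att W (flip W h) \<in> black_verts W}"
      by (rule image_eqI[of _ _ "flip W h"]) (use h W0_flip W0_black_blue in auto)
  qed (use W0_flip in auto)
  have "darts (projected W) = ?Z \<union> flip W ` ?Z"
    unfolding fZ unfolding Z by (auto simp: projected_def)
  moreover have "finite ?Z" using finite_blue by auto
  moreover have "?Z \<inter> flip W ` ?Z = {}"
    unfolding fZ unfolding Z by auto
  ultimately have "card (darts (projected W)) = card ?Z + card (flip W ` ?Z)"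
    by (simp add: card_Un_disjoint)
  moreover have "card (flip W ` ?Z) = card ?Z" by (rule card_flip_image) (auto simp: blue_simps)
  ultimately show ?thesis using card_cilia by simp
qed

lemma card_verts_projected:
  "card (verts (projected W)) = card (black_verts W) + card (components (blue_part W))"
proof -
  have "Inl ` black_verts W \<inter> Inr ` components (blue_part W) = {}" by auto
  then show ?thesis
    using finite_components finite_subset[OF W0_black W0_finite(1)]
    by (simp add: projected_def card_Un_disjoint card_image)
qed

lemma num_white_eq: "num_white W = card (components (blue_part W))"
proof -
  have "verts (projected W) \<inter> range Inr = Inr ` components (blue_part W)"
    by (auto simp: projected_def)
  then show ?thesis by (simp add: num_white_def card_image)
qed

text \<open>The contraction on vertices, as a function so that cuts of the projected map can be
  pulled back to \<open>W\<close>.\<close>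

definition proj_vert :: "'v \<Rightarrow> 'v + 'v set" where
  "proj_vert v = (if v \<in> black_verts W then Inl v else Inr (component_of (blue_part W) v))"

lemma att_projected: "att (projected W) h = proj_vert (att W h)"
  by (simp add: projected_def proj_vert_def)

text \<open>Edges inside a copy are contracted, so none of them crosses a pulled-back cut.\<close>

lemma proj_vert_blue:
  assumes "h \<in> darts W - darts (projected W)"
  shows "proj_vert (att W (flip W h)) = proj_vert (att W h)"
proof -
  have h: "h \<in> darts W" "att W h \<notin> black_verts W" "att W (flip W h) \<notin> black_verts W"
    using assms by (auto simp: projected_def)
  then have "h \<in> darts (blue_part W)" "flip (blue_part W) h = flip W h" by (auto simp: blue_simps)
  then show ?thesis using blue_component_flip[of h] h by (simp add: proj_vert_def)
qed

lemma proj_vert_in: "v \<in> verts W \<Longrightarrow> proj_vert v \<in> verts (projected W)"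
  by (auto simp: projected_def proj_vert_def blue_simps intro!: component_of_in)

lemma wf_projected: "wf_graph (projected W)"
  unfolding wf_graph_def
proof (intro conjI)
  show "finite (verts (projected W))"
    using finite_components finite_subset[OF W0_black W0_finite(1)] by (simp add: projected_def)
  show "finite (darts (projected W))" using W0_finite by (simp add: projected_def)
  show "att (projected W) ` darts (projected W) \<subseteq> verts (projected W)"
    unfolding att_projected using proj_vert_in W0_att by (auto simp: projected_def)
  show "\<forall>h\<in>darts (projected W). flip (projected W) h \<in> darts (projected W)
      \<and> flip (projected W) (flip (projected W) h) = h"
    using W0_flip by (auto simp: projected_def)
qed

lemma projected_flip: "flip (projected W) = flip W"
  and projected_darts: "darts (projected W) \<subseteq> darts W"
  by (auto simp: projected_def)

lemma verts_projected: "verts (projected W) = proj_vert ` verts W"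
  using W0_black by (auto simp: projected_def proj_vert_def blue_simps components_def image_iff)

lemma connected_projected: "connected_graph (projected W)"
  unfolding connected_graph_def connected_by_def
proof (intro conjI ballI)
  have conn: "verts W \<noteq> {}" "\<And>x y. x \<in> verts W \<Longrightarrow> y \<in> verts W \<Longrightarrow> (x, y) \<in> reach (verts W) (adj W)"
    using W0_connected by (auto simp: connected_graph_def connected_by_def)
  show "verts (projected W) \<noteq> {}" using conn(1) by (simp add: verts_projected)
  fix x y assume "x \<in> verts (projected W)" "y \<in> verts (projected W)"
  then obtain u v where uv: "u \<in> verts W" "v \<in> verts W" "x = proj_vert u" "y = proj_vert v"
    by (auto simp: verts_projected)
  let ?E = "reach (verts (projected W)) (adj (projected W))"
  have adjW: "adj W \<subseteq> verts W \<times> verts W"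
    using W0_att W0_flip by (auto simp: adj_def)
  from conn(2)[OF uv(1,2)] adjW have "(proj_vert u, proj_vert v) \<in> ?E"
  proof (induction rule: reach_induct)
    case refl
    show ?case using proj_vert_in[OF uv(1)] by (auto simp: reach_def)
  next
    case (step y z)
    have "(proj_vert a, proj_vert b) \<in> ?E" if ab: "(a, b) \<in> adj W" for a b
    proof -
      obtain h where h: "h \<in> darts W" "a = att W h" "b = att W (flip W h)"
        using ab by (auto simp: adj_def)
      then have V: "proj_vert a \<in> verts (projected W)" "proj_vert b \<in> verts (projected W)"
        using proj_vert_in W0_att W0_flip by auto
      show ?thesis
      proof (cases "h \<in> darts (projected W)")
        case True
        then have "(proj_vert a, proj_vert b) \<in> adj (projected W)"
          unfolding adj_def att_projected projected_flip using h by auto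
        then show ?thesis using V by (intro reach_edge)
      next
        case False
        then show ?thesis using h V proj_vert_blue[of h] by (auto simp: reach_def)
      qed
    qed
    then have "(proj_vert y, proj_vert z) \<in> ?E" using step.hyps(2) by (auto intro: reach_sym)
    with step.IH show ?case by (rule reach_trans)
  qed
  then show "(x, y) \<in> ?E" using uv by simp
qed

text \<open>The edges are the cilia of all copies, and the final 1 is the single component.\<close>

lemma circuit_rank_projected:
  "circuit_rank (projected W) = int (card (components (blue_part W)) * card {k \<in> darts R. flip R k = k})
     - int (card (black_verts W)) - int (card (components (blue_part W))) + 1"
proof -
  have "2 * card (edges (projected W)) = card (darts (projected W))"
    using card_darts_eq_edges[OF wf_projected] W0_nofix projected_darts by (metis projected_flip subsetD)
  then show ?thesis
    unfolding circuit_rank_def card_verts_projected components_connected[OF connected_projected]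
    using card_darts_projected by simp
qed

section \<open>Monochromatic submaps and their faces\<close>

lemma mono_darts_flip_closed: "flip W ` {h \<in> darts W. i \<in> label W h} \<subseteq> {h \<in> darts W. i \<in> label W h}"
  using W0_flip W0_label_flip by auto

lemma card_mono_edges: "2 * card (edges (mono_submap i W)) = card {h \<in> darts W. i \<in> label W h}"
proof -
  have "wf_graph (mono_submap i W)"
    unfolding wf_graph_def mono_submap_def Let_def
    using W0_finite W0_att W0_flip W0_label_flip by auto
  from card_darts_eq_edges[OF this] show ?thesis
    using W0_nofix by (simp add: mono_submap_def Let_def)
qed

text \<open>The right-hand side depends on \<open>W\<close> only through the number of copies of \<open>R\<close>.\<close>

lemma rank_count_W0:
  "real D * real (card (verts W)) + real D * real_of_int (circuit_rank (projected W))
     - (\<Sum>i=1..D. real (card (edges (mono_submap i W)))) =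
   real D * (real (num_white W) * (real (card (verts R)) + real (card {k \<in> darts R. flip R k = k}) - 1) + 1)
     - (\<Sum>i=1..D. real (num_white W) * (real (card {k \<in> darts R. i \<in> label R k}) / 2 +
         real (card {k \<in> darts R. flip R k = k \<and> (\<exists>l\<in>darts R. att R l = att R k \<and> i \<in> label R l)})))"
proof -
  have "real (card (edges (mono_submap i W))) = real (num_white W) * (real (card {k \<in> darts R. i \<in> label R k}) / 2 +
         real (card {k \<in> darts R. flip R k = k \<and> (\<exists>l\<in>darts R. att R l = att R k \<and> i \<in> label R l)}))" for i
  proof -
    have "2 * real (card (edges (mono_submap i W))) = real (card {h \<in> darts W. i \<in> label W h})"
      by (simp flip: card_mono_edges)
    then show ?thesis
      unfolding card_colored_darts num_white_eq by (simp add: algebra_simps)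
  qed
  then show ?thesis
    by (simp add: circuit_rank_projected card_verts_W0 num_white_eq algebra_simps)
qed

text \<open>Two uses of \<open>bridges_count\<close> telescope: from all edges of color
  \<open>i\<close> down to those inside copies, and from these down to none.\<close>

lemma num_faces_mono_tree:
  assumes tree: "is_tree (projected W)"
    and bridges: "\<And>k. k \<in> darts R \<Longrightarrow> i \<in> label R k \<Longrightarrow>
      is_bridge (att R) (flip R) {k \<in> darts R. i \<in> label R k} k"
  shows "num_faces (mono_submap i W) + card (edges (mono_submap i W)) = card (verts W)"
proof -
  let ?S = "{h \<in> darts W. i \<in> label W h}"
  let ?S1 = "{h \<in> darts (blue_part W). i \<in> label (blue_part W) h}"
  let ?N = "\<lambda>X. card (orbit (rot W \<circ> partial_flip (flip W) X) ` darts W)"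
  have S1: "?S1 = ?S - darts (projected W)"
    by (auto simp: blue_simps projected_def)
  have flS: "flip W h \<in> ?S \<and> flip W (flip W h) = h \<and> flip W h \<noteq> h" if "h \<in> ?S" for h
    using that W0_flip W0_label_flip W0_nofix by auto
  have flS1: "flip W h \<in> ?S1" if "h \<in> ?S1" for h
    unfolding S1 using that[unfolded S1] flS[of h] by (auto simp: projected_def)
  have step: "?N X = Suc (?N (insert h (insert (flip W h) X)))"
    if "X \<subseteq> ?S" "flip W ` X \<subseteq> X" "h \<in> ?S - X" "is_bridge (att W) (flip W) X h" for X h
    using that by (intro orbits_face_perm_bridge[OF W0_wf]) auto
  have "2 * ?N ?S + card (?S - ?S1) = 2 * ?N ?S1"
  proof (rule bridges_count[where \<theta> = "flip W" and \<alpha> = "att W"])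
    fix h assume h: "h \<in> ?S - ?S1"
    then have hP: "h \<in> darts (projected W)" unfolding S1 by auto
    have "is_bridge (att (projected W)) (flip (projected W)) (darts (projected W)) h"
    proof (rule acyclic_is_bridge[OF wf_projected _ hP])
      show "\<nexists>hs. graph_cycle (projected W) hs" using tree by (simp add: is_tree_def)
      show "flip (projected W) k \<noteq> k" if "k \<in> darts (projected W)" for k
        using that W0_nofix projected_darts by (auto simp: projected_flip)
    qed
    then obtain A where A: "proj_vert (att W h) \<in> A" "proj_vert (att W (flip W h)) \<notin> A"
      "\<And>k. k \<in> darts (projected W) - {h, flip W h} \<Longrightarrow>
         proj_vert (att W k) \<in> A \<longleftrightarrow> proj_vert (att W (flip W k)) \<in> A"
      unfolding is_bridge_def att_projected projected_flip by blast
    show "is_bridge (att W) (flip W) ?S h"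
      unfolding is_bridge_def
    proof (intro exI[of _ "proj_vert -` A"] conjI ballI)
      fix k assume k: "k \<in> ?S - {h, flip W h}"
      show "att W k \<in> proj_vert -` A \<longleftrightarrow> att W (flip W k) \<in> proj_vert -` A"
      proof (cases "k \<in> darts (projected W)")
        case True
        then show ?thesis using A(3)[of k] k by simp
      next
        case False
        then show ?thesis using proj_vert_blue[of k] k by simp
      qed
    qed (use A in auto)
  next
    show "flip W h \<in> ?S \<and> flip W (flip W h) = h \<and> flip W h \<noteq> h" if "h \<in> ?S" for h
      using flS that .
    show "flip W h \<in> ?S1" if "h \<in> ?S1" for h using flS1 that .
    show "?S1 \<subseteq> ?S" unfolding S1 by blast
    show "finite ?S" using W0_finite by simp
    show "?N X = Suc (?N (insert h (insert (flip W h) X)))"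
      if "X \<subseteq> ?S" "flip W ` X \<subseteq> X" "h \<in> ?S - X" "is_bridge (att W) (flip W) X h" for X h
      by (rule step[OF that])
  qed
  \<comment> \<open>With the black-blue edges absent, a cut within a single copy is enough.\<close>
  moreover have "2 * ?N ?S1 + card (?S1 - {}) = 2 * ?N {}"
  proof (rule bridges_count[where \<theta> = "flip W" and \<alpha> = "att W"])
    fix h assume "h \<in> ?S1 - {}"
    then have h: "h \<in> darts (blue_part W)" "i \<in> label (blue_part W) h" by auto
    define C where "C = component_of (blue_part W) (att W h)"
    have C: "C \<in> components (blue_part W)" "att W h \<in> C"
      unfolding C_def using blue_component[OF h(1)] by auto
    obtain f g where fg: "bij_betw f C (verts R)"
      "bij_betw g {h \<in> darts (blue_part W). att W h \<in> C} (darts R)"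
      "\<And>h. h \<in> darts (blue_part W) \<Longrightarrow> att W h \<in> C \<Longrightarrow> att R (g h) = f (att W h)
       \<and> flip R (g h) = g (flip (blue_part W) h) \<and> label R (g h) = label (blue_part W) h"
      using blue_iso[OF C(1)] by blast
    have flip_eq: "flip (blue_part W) k = flip W k" if "k \<in> ?S1" for k
      using that by (auto simp: blue_simps split: if_splits)
    have g_in: "g k \<in> darts R" if "k \<in> darts (blue_part W)" "att W k \<in> C" for k
      using fg(2) that by (auto simp: bij_betw_def)
    have "is_bridge (att R) (flip R) {k \<in> darts R. i \<in> label R k} (g h)"
      using bridges g_in[OF h(1) C(2)] fg(3)[OF h(1) C(2)] h(2) by auto
    then obtain A where A: "att R (g h) \<in> A" "att R (flip R (g h)) \<notin> A"
      "\<And>k. k \<in> {k \<in> darts R. i \<in> label R k} - {g h, flip R (g h)} \<Longrightarrow>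
         att R k \<in> A \<longleftrightarrow> att R (flip R k) \<in> A"
      unfolding is_bridge_def by blast
    have both: "flip W k \<in> darts (blue_part W)" "att W (flip W k) \<in> C" "flip R (g k) = g (flip W k)"
      "att R (g k) = f (att W k)" "att R (flip R (g k)) = f (att W (flip W k))"
      if "k \<in> ?S1" "att W k \<in> C" for k
    proof -
      have k: "k \<in> darts (blue_part W)" using that by auto
      show 1: "flip W k \<in> darts (blue_part W)" "att W (flip W k) \<in> C"
        using blue_flip[OF k] blue_component_flip_iff[OF k C(1)] flip_eq[OF that(1)] that by auto
      show "flip R (g k) = g (flip W k)" "att R (g k) = f (att W k)"
        using fg(3)[OF k that(2)] flip_eq[OF that(1)] by auto
      then show "att R (flip R (g k)) = f (att W (flip W k))" using fg(3)[OF 1] by simp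
    qed
    have hS1: "h \<in> ?S1" using h by simp
    show "is_bridge (att W) (flip W) ?S1 h"
      unfolding is_bridge_def
    \<comment> \<open>The cut of \<open>R\<close>, carried into the copy \<open>C\<close> alone;
      edges of the other copies have both ends outside it.\<close>
    proof (intro exI[of _ "{v \<in> C. f v \<in> A}"] conjI ballI)
      show "att W h \<in> {v \<in> C. f v \<in> A}" "att W (flip W h) \<notin> {v \<in> C. f v \<in> A}"
        using A(1,2) both[OF hS1 C(2)] C(2) by auto
      fix k assume k: "k \<in> ?S1 - {h, flip W h}"
      then have kS1: "k \<in> ?S1" by blast
      show "att W k \<in> {v \<in> C. f v \<in> A} \<longleftrightarrow> att W (flip W k) \<in> {v \<in> C. f v \<in> A}"
      proof (cases "att W k \<in> C")
        case True
        have inj: "g a = g b \<Longrightarrow> a = b" if "a \<in> darts (blue_part W)" "att W a \<in> C"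
          "b \<in> darts (blue_part W)" "att W b \<in> C" for a b
          using fg(2) that unfolding bij_betw_def by (blast dest: inj_onD)
        have "g k \<noteq> g h" "g k \<noteq> flip R (g h)"
          using inj[of k h] inj[of k "flip W h"] both[OF hS1 C(2)] k True h C by auto
        moreover have "g k \<in> darts R" "i \<in> label R (g k)"
          using g_in fg(3)[of k] kS1 True by auto
        ultimately show ?thesis using A(3)[of "g k"] both[OF kS1 True] True by auto
      next
        case False
        then have "att W (flip W k) \<notin> C"
          using blue_component_flip_iff[of k C] kS1 C flip_eq[OF kS1] by auto
        then show ?thesis using False by simp
      qed
    qed
  next
    show "flip W h \<in> ?S1 \<and> flip W (flip W h) = h \<and> flip W h \<noteq> h" if "h \<in> ?S1" for h
      using flS1[OF that] flS[of h] that unfolding S1 by blast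
    fix X h assume X: "X \<subseteq> ?S1" "flip W ` X \<subseteq> X" "h \<in> ?S1 - X" "is_bridge (att W) (flip W) X h"
    then have "X \<subseteq> ?S" "h \<in> ?S - X" unfolding S1 by blast+
    from step[OF this(1) X(2) this(2) X(4)] show "?N X = Suc (?N (insert h (insert (flip W h) X)))" .
  qed (use finite_blue in auto)
  \<comment> \<open>With no edge switched on, the permutation is \<open>rot W\<close>, whose orbits
    are the vertices that carry darts.\<close>
  moreover have "?N {} = card (att W ` darts W)"
  proof -
    have "orbit (rot W \<circ> partial_flip (flip W) {}) ` darts W = (\<lambda>v. {h \<in> darts W. att W h = v}) ` (att W ` darts W)"
      using W0_wf by (auto simp: wf_map_def partial_flip_def comp_def image_image)
    moreover have "inj_on (\<lambda>v. {h \<in> darts W. att W h = v}) (att W ` darts W)"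
      by (rule inj_onI) auto
    ultimately show ?thesis by (simp add: card_image)
  qed
  moreover have "card ?S = card (?S - ?S1) + card ?S1"
  proof -
    have "?S1 \<subseteq> ?S" "finite ?S" unfolding S1 using W0_finite by auto
    then show ?thesis
      using card_Diff_subset[of ?S1 ?S] card_mono[of ?S ?S1] finite_subset[of ?S1 ?S] by linarith
  qed
  moreover have "num_faces (mono_submap i W) = ?N ?S + card (verts W - att W ` darts W)"
    unfolding mono_submap_def Let_def
    by (rule num_faces_submap[OF W0_wf _ mono_darts_flip_closed]) auto
  moreover have "card (verts W) = card (att W ` darts W) + card (verts W - att W ` darts W)"
  proof -
    have "att W ` darts W \<subseteq> verts W" using W0_att by auto
    then show ?thesis
      using card_Diff_subset[of "att W ` darts W" "verts W"] card_mono[of "verts W" "att W ` darts W"]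
        W0_finite by simp
  qed
  ultimately show ?thesis using card_mono_edges[of i] by simp
qed

end

section \<open>The face formula\<close>

lemma num_faces_genus:
  "real (num_faces M) = real (card (verts M)) - real (card (edges M))
     + 2 * real_of_int (circuit_rank M) - 2 * genus M"
proof -
  have "2 * genus M = 2 * real (card (components M)) + real (card (edges M))
      - real (card (verts M)) - real (num_faces M)"
    by (simp add: genus_def)
  then show ?thesis by (simp add: circuit_rank_def)
qed

theorem theorem4:
  fixes D :: nat and B :: "('a, 'e) bubble" and \<Omega> :: "('a \<times> 'a) set"
    and R :: "(('a \<times> 'a) rvert, ('a \<times> 'a, ('a \<times> 'a, 'e) mdart) rdart) colored_map"
    and W :: "('v, 'h) stuffed_map" and T :: "('w, 'k) stuffed_map"
  assumes "D \<ge> 2"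
    and "is_bubble D B"
    and "is_pairing B \<Omega>"
    and "is_reduced_map D B \<Omega> R"
    and "W \<in> W0 R"
    and "T \<in> W0 R"
    and "is_tree (projected T)"
    and "num_white T = num_white W"
  shows "real (total_faces D W) - real (total_faces D T) =
      - real D * real_of_int (circuit_rank (projected W))
      + 2 * (\<Sum>i=1..D. real_of_int (circuit_rank (mono_submap i W)))
      - 2 * (\<Sum>i=1..D. genus (mono_submap i W))"
proof -
  obtain M t where Mt: "is_bubble_map B \<Omega> M" "is_treatment D M t" "is_reduction_by D M t R"
    using assms(4) by (auto simp: is_reduced_map_def)
  have "real (num_faces (mono_submap i T)) = real (card (verts T)) - real (card (edges (mono_submap i T)))"
    if "i \<in> {1..D}" for i
    using num_faces_mono_tree[OF assms(6,7) reduced_map_bridge[OF assms(2,3) Mt that]] by fastforce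
  then have FT: "real (total_faces D T) = real D * real (card (verts T))
      - (\<Sum>i=1..D. real (card (edges (mono_submap i T))))"
    by (simp add: total_faces_def sum_subtractf)
  have FW: "real (total_faces D W) = real D * real (card (verts W))
      - (\<Sum>i=1..D. real (card (edges (mono_submap i W))))
      + 2 * (\<Sum>i=1..D. real_of_int (circuit_rank (mono_submap i W)))
      - 2 * (\<Sum>i=1..D. genus (mono_submap i W))"
  proof -
    have "real (num_faces (mono_submap i W)) = real (card (verts W)) - real (card (edges (mono_submap i W)))
     + 2 * real_of_int (circuit_rank (mono_submap i W)) - 2 * genus (mono_submap i W)" for i
      using num_faces_genus[of "mono_submap i W"] by (simp add: mono_submap_def Let_def)
    then show ?thesis
      by (simp add: total_faces_def sum_subtractf sum.distrib sum_distrib_left)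
  qed
  have nofix: "flip (projected T) h \<noteq> h" if "h \<in> darts (projected T)" for h
    using that W0_nofix[OF assms(6)] by (auto simp: projected_def)
  have "circuit_rank (projected T) = 0"
    using tree_card_darts[OF assms(7) wf_projected[OF assms(6)] nofix]
      card_darts_eq_edges[OF wf_projected[OF assms(6)] nofix]
      components_connected[OF connected_projected[OF assms(6)]]
    by (simp add: circuit_rank_def)
  \<comment> \<open>Equal numbers of copies make the two rank counts equal. As L vanishes for
    \<open>T\<close>, the quantity D V - \<Sum>i. E i of \<open>W\<close> equals the number of faces
    of \<open>T\<close> minus D L of \<open>W\<close>.\<close>
  then show ?thesis
    using rank_count_W0[OF assms(5), of D] rank_count_W0[OF assms(6), of D] FT FW assms(8) by simp
qed

end
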